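(* Let $n\in\mathbb N$, $n\ge2$, let $\Omega$ be a John domain in $\mathbb R^n$ (with $|\Omega|=1$), and let $\|\cdot\|_{X(0,1)}$ be a rearrangement-invariant function norm. Let $k,h\in\mathbb N$. Then $$\big(X_{k,\mathrm{John}}\big)_{h,\mathrm{John}}(\Omega)=X_{k+h,\mathrm{John}}(\Omega),$$ up to equivalent norms.
   Context: Domains are open connected sets in $\mathbb R^n$, equipped with Lebesgue measure, normalized so that $|\Omega|=1$. A bounded domain $\Omega\subset\mathbb R^n$ is a John domain if there exist $c\in(0,1)$ and $x_0\in\Omega$ such that for every $x\in\Omega$ there is a rectifiable curve $\varpi:[0,l]\to\Omega$, parameterized by arclength, with $\varpi(0)=x$, $\varpi(l)=x_0$ and $\operatorname{dist}(\varpi(r),\partial\Omega)\ge cr$ for $r\in[0,l]$. Rearrangement-invariant (r.i.) spaces. $\mathcal M_+(0,1)$ is the set of measurable functions $(0,1)\to[0,\infty]$. For a measurable $u:\Omega\to[-\infty,\infty]$, $u^*(s)=\sup\{t\in\mathbb R:|\{x\in\Omega:|u(x)|>t\}|>s\}$ for $s\in(0,1)$ (similarly for functions on $(0,1)$). An r.i. function norm is a functional $\|\cdot\|_{X(0,1)}:\mathcal M_+(0,1)\to[0,\infty]$ such that for all $f,g,f_j\in\mathcal M_+(0,1)$ and $\lambda\ge0$: (P1) $\|f\|=0$ iff $f=0$ a.e., $\|\lambda f\|=\lambda\|f\|$, $\|f+g\|\le\|f\|+\|g\|$; (P2) $f\le g$ a.e. implies $\|f\|\le\|g\|$; (P3)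 $f_j\nearrow f$ a.e. implies $\|f_j\|\nearrow\|f\|$; (P4) $\|1\|<\infty$; (P5) $\int_0^1f\,dx\le C\|f\|$ with $C$ independent of $f$; (P6) $\|f\|=\|g\|$ whenever $f^*=g^*$. The associate norm is $\|g\|_{X'(0,1)}=\sup\{\int_0^1fg\,ds:f\ge0,\ \|f\|_{X(0,1)}\le1\}$, again an r.i. function norm, and $X''=X$. The space $X(\Omega)$ consists of all measurable $u$ on $\Omega$ with $\|u\|_{X(\Omega)}:=\|u^*\|_{X(0,1)}<\infty$. For $m\in\mathbb N$ and an r.i. function norm $\|\cdot\|_{X(0,1)}$, $\|\cdot\|_{X_{m,\mathrm{John}}(0,1)}$ is the r.i. function norm whose associate norm is $$\|f\|_{X'_{m,\mathrm{John}}(0,1)}=\left\|s^{-1+\frac mn}\int_0^sf^*(r)\,dr\right\|_{X'(0,1)},\qquad f\in\mathcal M_+(0,1).$$ The space $(X_{k,\mathrm{John}})_{h,\mathrm{John}}$ is obtained by applying this construction with $m=h$ to the norm $\|\cdot\|_{X_{k,\mathrm{John}}(0,1)}$. *)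

theory Defs
  imports "HOL-Analysis.Analysis"
begin

section \<open>John domains\<close>

text \<open>Length of the restriction of a curve to \<open>[a, b]\<close>: supremum of the lengths of inscribed
  polygons, a partition being a sorted list of points of \<open>[a, b]\<close>.\<close>

definition curve_length :: "(real \<Rightarrow> 'a::metric_space) \<Rightarrow> real \<Rightarrow> real \<Rightarrow> ennreal" where
  "curve_length g a b =
     (SUP xs \<in> {xs. sorted xs \<and> set xs \<subseteq> {a..b}}.
        \<Sum>i<length xs - 1. ennreal (dist (g (xs ! i)) (g (xs ! Suc i))))"

text \<open>Rectifiability is implied: the length of the whole curve is \<open>l < \<infinity>\<close>.\<close>

definition arclength_parametrized :: "(real \<Rightarrow> 'a::metric_space) \<Rightarrow> real \<Rightarrow> bool" where
  "arclength_parametrized g l \<longleftrightarrow>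
     0 \<le> l \<and> continuous_on {0..l} g \<and> (\<forall>r\<in>{0..l}. curve_length g 0 r = ennreal r)"

definition john_domain :: "'a::euclidean_space set \<Rightarrow> bool" where
  "john_domain \<Omega> \<longleftrightarrow>
     open \<Omega> \<and> connected \<Omega> \<and> bounded \<Omega> \<and>
     (\<exists>c x0. 0 < c \<and> c < 1 \<and> x0 \<in> \<Omega> \<and>
        (\<forall>x\<in>\<Omega>. \<exists>(l::real) \<gamma>.
            arclength_parametrized \<gamma> l \<and> \<gamma> ` {0..l} \<subseteq> \<Omega> \<and> \<gamma> 0 = x \<and> \<gamma> l = x0 \<and>
            (\<forall>r\<in>{0..l}. infdist (\<gamma> r) (frontier \<Omega>) \<ge> c * r)))"

section \<open>Rearrangement-invariant function norms\<close>

abbreviation I01 :: "real measure" where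
  "I01 \<equiv> lebesgue_on {0<..<1}"

abbreviation M_plus :: "(real \<Rightarrow> ennreal) set" where
  "M_plus \<equiv> borel_measurable I01"

text \<open>Decreasing rearrangement. On a space of total measure 1 and for \<open>0 < s < 1\<close> every \<open>t < 0\<close>
  belongs to the index set, so the supremum in \<open>ereal\<close> is nonnegative and the conversion
  to \<open>ennreal\<close> does not change it.\<close>

definition rearr :: "'a measure \<Rightarrow> ('a \<Rightarrow> ereal) \<Rightarrow> real \<Rightarrow> ennreal" where
  "rearr M u s =
     e2ennreal (SUP t \<in> {t::real. emeasure M {x \<in> space M. \<bar>u x\<bar> > ereal t} > ennreal s}. ereal t)"

abbreviation rearr01 :: "(real \<Rightarrow> ennreal) \<Rightarrow> real \<Rightarrow> ennreal" where
  "rearr01 f \<equiv> rearr I01 (\<lambda>x. enn2ereal (f x))"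

text \<open>A function norm is a functional on \<open>M_plus\<close>; its values outside \<open>M_plus\<close> are irrelevant, and by
  monotonicity it only sees the values of its argument on the open unit interval.\<close>

definition ri_function_norm :: "((real \<Rightarrow> ennreal) \<Rightarrow> ennreal) \<Rightarrow> bool" where
  "ri_function_norm N \<longleftrightarrow>
     (\<forall>f\<in>M_plus. N f = 0 \<longleftrightarrow> (AE s in I01. f s = 0)) \<and>
     (\<forall>f\<in>M_plus. \<forall>c::real. c \<ge> 0 \<longrightarrow> N (\<lambda>s. ennreal c * f s) = ennreal c * N f) \<and>
     (\<forall>f\<in>M_plus. \<forall>g\<in>M_plus. N (\<lambda>s. f s + g s) \<le> N f + N g) \<and>
     (\<forall>f\<in>M_plus. \<forall>g\<in>M_plus. (AE s in I01. f s \<le> g s) \<longrightarrow> N f \<le> N g) \<and>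
     (\<forall>F f. (\<forall>j::nat. F j \<in> M_plus) \<longrightarrow> f \<in> M_plus \<longrightarrow>
        (AE s in I01. incseq (\<lambda>j. F j s) \<and> (\<lambda>j. F j s) \<longlonglongrightarrow> f s) \<longrightarrow>
        incseq (\<lambda>j. N (F j)) \<and> (\<lambda>j. N (F j)) \<longlonglongrightarrow> N f) \<and>
     N (\<lambda>_. 1) < \<infinity> \<and>
     (\<exists>C::real. \<forall>f\<in>M_plus. (\<integral>\<^sup>+ s. f s \<partial>I01) \<le> ennreal C * N f) \<and>
     (\<forall>f\<in>M_plus. \<forall>g\<in>M_plus. (\<forall>s\<in>{0<..<1}. rearr01 f s = rearr01 g s) \<longrightarrow> N f = N g)"

definition associate_norm :: "((real \<Rightarrow> ennreal) \<Rightarrow> ennreal) \<Rightarrow> (real \<Rightarrow> ennreal) \<Rightarrow> ennreal" where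
  "associate_norm N g = (SUP f \<in> {f \<in> M_plus. N f \<le> 1}. \<integral>\<^sup>+ s. f s * g s \<partial>I01)"

text \<open>\<open>john_norm n m X\<close> is the r.i. function norm with the prescribed associate norm. By the
  Lorentz--Luxemburg theorem (\<open>Y'' = Y\<close>) it is uniquely determined on \<open>M_plus\<close>, so
  the choice only concerns irrelevant values outside \<open>M_plus\<close>.\<close>

definition john_norm ::
  "nat \<Rightarrow> nat \<Rightarrow> ((real \<Rightarrow> ennreal) \<Rightarrow> ennreal) \<Rightarrow> (real \<Rightarrow> ennreal) \<Rightarrow> ennreal" where
  "john_norm n m X =
     (SOME Y. ri_function_norm Y \<and>
        (\<forall>f\<in>M_plus. associate_norm Y f =
           associate_norm X (\<lambda>s. ennreal (s powr (-1 + real m / real n)) *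
                                 (\<integral>\<^sup>+ r\<in>{0<..<s}. rearr01 f r \<partial>lebesgue))))"

section \<open>Function spaces over a domain\<close>

definition ri_norm_on ::
  "((real \<Rightarrow> ennreal) \<Rightarrow> ennreal) \<Rightarrow> 'a::euclidean_space set \<Rightarrow> ('a \<Rightarrow> ereal) \<Rightarrow> ennreal" where
  "ri_norm_on X \<Omega> u = X (rearr (lebesgue_on \<Omega>) u)"

definition ri_space ::
  "((real \<Rightarrow> ennreal) \<Rightarrow> ennreal) \<Rightarrow> 'a::euclidean_space set \<Rightarrow> ('a \<Rightarrow> ereal) set" where
  "ri_space X \<Omega> = {u \<in> borel_measurable (lebesgue_on \<Omega>). ri_norm_on X \<Omega> u < \<infinity>}"

definition ri_spaces_equivalent ::
  "((real \<Rightarrow> ennreal) \<Rightarrow> ennreal) \<Rightarrow> ((real \<Rightarrow> ennreal) \<Rightarrow> ennreal) \<Rightarrow>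
   'a::euclidean_space set \<Rightarrow> bool" where
  "ri_spaces_equivalent X Y \<Omega> \<longleftrightarrow>
     ri_space X \<Omega> = ri_space Y \<Omega> \<and>
     (\<exists>c C::real. 0 < c \<and> 0 < C \<and>
        (\<forall>u\<in>ri_space X \<Omega>. ennreal c * ri_norm_on X \<Omega> u \<le> ri_norm_on Y \<Omega> u \<and>
                        ri_norm_on Y \<Omega> u \<le> ennreal C * ri_norm_on X \<Omega> u))"

end

theory Submission
  imports Defs
begin

text \<open>
  Writing \<open>T\<^sub>a f(s) = s\<^sup>a\<^sup>-\<^sup>1 \<integral>\<^sub>0\<^sup>s f\<^sup>*\<close>, the associate norms of the two spaces are \<open>X'(T\<^sub>a (T\<^sub>b f))\<close> and
  \<open>X'(T\<^sub>a\<^sub>+\<^sub>b f)\<close> with \<open>a = k/n\<close>, \<open>b = h/n\<close>; since r.i. norms are determined by their associates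
  (Lorentz--Luxemburg), it suffices to compare these two. Concavity of \<open>s \<mapsto> \<integral>\<^sub>0\<^sup>s f\<^sup>*\<close> gives
  \<open>T\<^sub>a\<^sub>+\<^sub>b f \<le> (1 + b) T\<^sub>a (T\<^sub>b f)\<close> pointwise. Conversely \<open>T\<^sub>a (T\<^sub>b f) \<le> G + T\<^sub>a\<^sub>+\<^sub>b f / b\<close> with
  \<open>G(s) = sup {T\<^sub>a\<^sub>+\<^sub>b f(t) | s \<le> t < 1}\<close>. The function \<open>G\<close> is not pointwise comparable to \<open>T\<^sub>a\<^sub>+\<^sub>b f\<close>, but
  \<open>\<integral>\<^sub>0\<^sup>s G\<^sup>* \<le> C \<integral>\<^sub>0\<^sup>s (T\<^sub>a\<^sub>+\<^sub>b f)\<^sup>*\<close>, so Hardy's lemma bounds its norm in \<open>X'\<close>.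
\<close>

section \<open>Decreasing rearrangements\<close>

text \<open>The majorant G can be much larger than what it majorizes: for f = 1 the function
  \<open>hardy_op (a + b) f\<close> is s^(a+b), which tends to 0 at 0, while G is constantly 1. What
  saves the integrals is concavity once more: the value of \<open>hardy_op c f\<close> at t exceeds
  those on (t/2, t) by at most a fixed factor. A large value at some t >= s therefore occupies a set
  of measure about s, and rearranging moves such a set to the left end. Two further points shape the
  development. \<open>john_norm\<close> chooses a norm by its associate, so a witness is needed: f
  -> X'(T_a f) must be shown to be an r.i. norm, and its associate is the witness. Also, an
  associate norm must depend on rearrangements only, which requires a function equimeasurable with f
  and aligned with g. This alignment and the triangle inequality of the new norm both come from one
  measure-preserving map, by which the integral of f* over (0, s) is attained by f on a set of
  measure s. The equality of a norm with its second associate is obtained from a projection in L^2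
  instead of an abstract separation theorem.\<close>

lemma ennreal_le_if_real_less:
  fixes a b :: ennreal
  assumes "\<And>t::real. 0 \<le> t \<Longrightarrow> ennreal t < a \<Longrightarrow> ennreal t \<le> b"
  shows "a \<le> b"
proof (rule ccontr)
  assume "\<not> a \<le> b"
  then obtain c where c: "b < c" "c < a" using dense[of b a] by (auto simp: not_le)
  then have "c < top" using less_le_trans top_greatest by blast
  then obtain t where "0 \<le> t" "c = ennreal t" by (cases c) auto
  with assms[of t] c show False by auto
qed

lemma ennreal_eq_if_real_less:
  fixes a b :: ennreal
  assumes "\<And>t::real. 0 \<le> t \<Longrightarrow> ennreal t < a \<longleftrightarrow> ennreal t < b"
  shows "a = b"
  by (rule antisym; rule ennreal_le_if_real_less) (use assms in \<open>auto intro: less_imp_le\<close>)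

lemma less_e2ennreal_iff: "0 \<le> t \<Longrightarrow> ennreal t < e2ennreal x \<longleftrightarrow> ereal t < x"
  by (cases x) (auto simp: ennreal_less_iff ennreal_neg e2ennreal_neg)

lemma rearr_antimono: "s \<le> s' \<Longrightarrow> rearr M u s' \<le> rearr M u s"
  unfolding rearr_def
  by (intro e2ennreal_mono SUP_subset_mono) (auto intro: le_less_trans[OF ennreal_leI])

lemma borel_measurable_ennreal_antimono:
  fixes f :: "real \<Rightarrow> ennreal"
  assumes "\<And>x y. x \<le> y \<Longrightarrow> f y \<le> f x"
  shows "f \<in> borel_measurable borel"
proof (rule borel_measurableI_greater)
  fix c
  have "is_interval {x. c < f x}"
    unfolding is_interval_1 using assms by (auto intro: less_le_trans)
  then show "{x \<in> space borel. c < f x} \<in> sets borel"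
    by (simp add: real_interval_borel_measurable)
qed

lemma rearr_borel [measurable]: "rearr M u \<in> borel_measurable borel"
  by (rule borel_measurable_ennreal_antimono) (rule rearr_antimono)

lemma borel_imp_M_plus: "f \<in> borel_measurable borel \<Longrightarrow> f \<in> M_plus"
  by (intro measurable_restrict_space1 measurable_completion) simp

lemma rearr_M_plus [measurable]: "rearr M u \<in> M_plus"
  by (rule borel_imp_M_plus) (rule rearr_borel)

text \<open>Strict inequalities make the correspondence exact. If the superlevel set at t has
  measure above s, so does one at a slightly higher level, by continuity from below along t +
  1/(i+1); that level witnesses the strict bound for the supremum.\<close>

lemma less_rearr_iff:
  assumes [measurable]: "u \<in> borel_measurable M" and t: "0 \<le> t"
  shows "ennreal t < rearr M u s \<longleftrightarrow> ennreal s < emeasure M {x \<in> space M. ereal t < \<bar>u x\<bar>}"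
proof
  assume "ennreal t < rearr M u s"
  then obtain t' where t': "ennreal s < emeasure M {x \<in> space M. \<bar>u x\<bar> > ereal t'}" "t < t'"
    using t by (auto simp: rearr_def less_e2ennreal_iff less_SUP_iff)
  have "emeasure M {x \<in> space M. \<bar>u x\<bar> > ereal t'} \<le> emeasure M {x \<in> space M. \<bar>u x\<bar> > ereal t}"
    using t'(2) by (intro emeasure_mono) (auto intro: less_trans[of "ereal t" "ereal t'"])
  with t' show "ennreal s < emeasure M {x \<in> space M. ereal t < \<bar>u x\<bar>}" by simp
next
  assume s: "ennreal s < emeasure M {x \<in> space M. ereal t < \<bar>u x\<bar>}"
  define A where "A i = {x \<in> space M. ereal (t + 1 / real (Suc i)) < \<bar>u x\<bar>}" for i
  have [measurable]: "A i \<in> sets M" for i unfolding A_def by measurable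
  have "incseq A"
  proof (rule incseq_SucI, unfold A_def, safe)
    fix i x assume a: "ereal (t + 1 / real (Suc i)) < \<bar>u x\<bar>"
    have "ereal (t + 1 / real (Suc (Suc i))) \<le> ereal (t + 1 / real (Suc i))"
      by (simp add: field_simps)
    with a show "ereal (t + 1 / real (Suc (Suc i))) < \<bar>u x\<bar>" by (rule le_less_trans[rotated])
  qed
  moreover have "(\<Union>i. A i) = {x \<in> space M. ereal t < \<bar>u x\<bar>}"
  proof (safe)
    fix i x assume "x \<in> A i"
    then show "ereal t < \<bar>u x\<bar>" unfolding A_def
      by (auto intro: less_trans[of _ "ereal (t + 1 / real (Suc i))"])
  next
    fix x assume x: "x \<in> space M" "ereal t < \<bar>u x\<bar>"
    then obtain z where z: "ereal t < ereal z" "ereal z < \<bar>u x\<bar>" using ereal_dense2 by blast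
    then obtain i where "1 / real (Suc i) < z - t" using nat_approx_posE[of "z - t"] by auto
    then have "ereal (t + 1 / real (Suc i)) < ereal z" by simp
    then have "ereal (t + 1 / real (Suc i)) < \<bar>u x\<bar>" using z(2) by (rule less_trans)
    then have "x \<in> A i" unfolding A_def using x by blast
    then show "x \<in> (\<Union>i. A i)" by blast
  qed (auto simp: A_def)
  ultimately have "(SUP i. emeasure M (A i)) = emeasure M {x \<in> space M. ereal t < \<bar>u x\<bar>}"
    using SUP_emeasure_incseq[of A M] by (simp add: image_subset_iff \<open>\<And>i. A i \<in> sets M\<close>)
  with s have "ennreal s < (SUP i. emeasure M (A i))" by simp
  then obtain i where i: "ennreal s < emeasure M (A i)" unfolding less_SUP_iff by blast
  show "ennreal t < rearr M u s"
    unfolding rearr_def less_e2ennreal_iff[OF t] less_SUP_iff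
    using i by (intro bexI[of _ "t + 1 / real (Suc i)"]) (auto simp: A_def)
qed

definition distr01 :: "(real \<Rightarrow> ennreal) \<Rightarrow> ennreal \<Rightarrow> ennreal" where
  "distr01 f t = emeasure I01 {x \<in> space I01. t < f x}"

lemma less_rearr01_iff:
  assumes "f \<in> M_plus" and t: "0 \<le> t"
  shows "ennreal t < rearr01 f s \<longleftrightarrow> ennreal s < distr01 f (ennreal t)"
proof -
  have "ereal t < \<bar>enn2ereal (f x)\<bar> \<longleftrightarrow> ennreal t < f x" for x
    using t by (simp add: less_ennreal.rep_eq enn2ereal_ennreal)
  then show ?thesis using less_rearr_iff[of "\<lambda>x. enn2ereal (f x)" I01 t s] t assms
    by (simp add: distr01_def)
qed

lemma emeasure_I01: "A \<in> sets I01 \<Longrightarrow> emeasure I01 A = emeasure lebesgue A"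
  by (subst emeasure_restrict_space) (auto simp: sets_restrict_space)

lemma emeasure_I01_interval:
  assumes "0 \<le> s" "s \<le> t" "t \<le> 1"
  shows "emeasure I01 {s<..<t} = ennreal (t - s)"
  using assms by (subst emeasure_restrict_space) auto

lemma emeasure_I01_le_1: "emeasure I01 A \<le> 1"
  using emeasure_space[of I01 A] emeasure_I01_interval[of 0 1] by simp

lemma distr01_le_1: "distr01 f t \<le> 1"
  unfolding distr01_def by (rule emeasure_I01_le_1)

text \<open>By \<open>less_rearr01_iff\<close>, r belongs to the level set iff r lies below the
  distribution function. The interval form is what decomposes integrals against
  \<open>rearr01 f\<close> into integrals over initial intervals in
  \<open>hardy_lemma\<close>.\<close>

lemma level_rearr01:
  assumes f: "f \<in> M_plus" and t: "0 \<le> t"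
  obtains d where "0 \<le> d" "d \<le> 1" "distr01 f (ennreal t) = ennreal d"
    "{r \<in> space I01. ennreal t < rearr01 f r} = {0<..<d}"
proof -
  obtain d where d: "distr01 f (ennreal t) = ennreal d" "0 \<le> d" "d \<le> 1"
    using distr01_le_1[of f "ennreal t"] by (cases "distr01 f (ennreal t)") (auto simp: top_unique)
  have "{r \<in> space I01. ennreal t < rearr01 f r} = {0<..<d}"
    unfolding less_rearr01_iff[OF f t] d(1) using d by (auto simp: ennreal_less_iff)
  then show thesis using that d by blast
qed

lemma distr01_rearr01:
  assumes f: "f \<in> M_plus" and t: "0 \<le> t"
  shows "distr01 (rearr01 f) (ennreal t) = distr01 f (ennreal t)"
proof -
  obtain d where "0 \<le> d" "d \<le> 1" "distr01 f (ennreal t) = ennreal d"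
    "{r \<in> space I01. ennreal t < rearr01 f r} = {0<..<d}"
    by (rule level_rearr01[OF f t]) (rule that)
  then show ?thesis using emeasure_I01_interval[of 0 d] by (simp add: distr01_def)
qed

lemma rearr01_mono_distr:
  assumes "f \<in> M_plus" "g \<in> M_plus"
    and "\<And>t. 0 \<le> t \<Longrightarrow> distr01 f (ennreal t) \<le> distr01 g (ennreal t)"
  shows "rearr01 f s \<le> rearr01 g s"
proof (rule ennreal_le_if_real_less)
  fix t :: real assume "0 \<le> t" "ennreal t < rearr01 f s"
  then show "ennreal t \<le> rearr01 g s"
    using assms less_rearr01_iff[of f t s] less_rearr01_iff[of g t s] by (force intro: less_imp_le)
qed

lemma sets_level_I01:
  assumes "f \<in> M_plus" shows "{x. 0 < x \<and> x < 1 \<and> t < f x} \<in> sets I01"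
proof -
  have "{x \<in> space I01. t < f x} \<in> sets I01" using assms by measurable
  then show ?thesis by simp
qed

lemma distr01_mono_AE:
  assumes "g \<in> M_plus" "AE s in I01. f s \<le> g s"
  shows "distr01 f t \<le> distr01 g t"
  unfolding distr01_def using assms
  by (intro emeasure_mono_AE) (auto elim!: eventually_mono simp: sets_level_I01)

lemma rearr01_mono_AE:
  assumes "f \<in> M_plus" "g \<in> M_plus" and "AE s in I01. f s \<le> g s"
  shows "rearr01 f s \<le> rearr01 g s"
  using assms by (intro rearr01_mono_distr distr01_mono_AE)

lemma rearr01_eq_distr:
  assumes "f \<in> M_plus" "g \<in> M_plus"
    and "\<And>t. 0 \<le> t \<Longrightarrow> distr01 f (ennreal t) = distr01 g (ennreal t)"
  shows "rearr01 f s = rearr01 g s"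
  using assms by (intro antisym rearr01_mono_distr) auto

lemma rearr01_rearr01: "f \<in> M_plus \<Longrightarrow> rearr01 (rearr01 f) s = rearr01 f s"
  by (rule rearr01_eq_distr) (auto simp: distr01_rearr01)

lemma rearr01_cong_AE:
  assumes "f \<in> M_plus" "g \<in> M_plus" and "AE s in I01. f s = g s"
  shows "rearr01 f s = rearr01 g s"
  using assms by (intro antisym rearr01_mono_AE) (auto elim!: eventually_mono)

lemma rearr01_0: "rearr01 (\<lambda>_. 0) s = 0"
  using less_rearr01_iff[of "\<lambda>_. 0" 0 s] by (simp add: distr01_def not_gr_zero)

text \<open>For c > 0, level t of the scaled function is level t / c of f, and equality at all real
  levels suffices. The case c = 0 has no such rescaling and is separate.\<close>

lemma rearr01_cmult:
  assumes [measurable]: "f \<in> M_plus" and c: "0 \<le> c"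
  shows "rearr01 (\<lambda>x. ennreal c * f x) s = ennreal c * rearr01 f s"
proof (cases "c = 0")
  case True then show ?thesis by (simp add: rearr01_0)
next
  case False
  with c have c: "0 < c" by simp
  have scale: "ennreal t < ennreal c * y \<longleftrightarrow> ennreal (t / c) < y" if "0 \<le> t" for t y
    using c that by (cases y) (auto simp: ennreal_mult[symmetric] ennreal_less_iff field_simps
      ennreal_mult_eq_top_iff ennreal_mult_top)
  have iff: "ennreal t < rearr01 (\<lambda>x. ennreal c * f x) s \<longleftrightarrow> ennreal t < ennreal c * rearr01 f s" if
    "0 \<le> t" for t
  proof -
    have "distr01 (\<lambda>x. ennreal c * f x) (ennreal t) = distr01 f (ennreal (t / c))"
      using that by (simp add: distr01_def scale)
    then show ?thesis
      using that c by (subst less_rearr01_iff) (auto simp: scale less_rearr01_iff)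
  qed
  show ?thesis
    by (rule ennreal_eq_if_real_less) (rule iff)
qed

lemma rearr01_const: "0 \<le> s \<Longrightarrow> s < 1 \<Longrightarrow> rearr01 (\<lambda>_. 1) s = 1"
proof -
  assume s: "0 \<le> s" "s < 1"
  have D: "distr01 (\<lambda>_. 1) (ennreal t) = (if t < 1 then 1 else 0)" if "0 \<le> t" for t
    using that emeasure_I01_interval[of 0 1]
      by (auto simp: distr01_def ennreal_less_one_iff greaterThanLessThan_def greaterThan_def
        lessThan_def Int_def)
  have iff: "ennreal t < rearr01 (\<lambda>_. 1) s \<longleftrightarrow> ennreal t < 1" if "0 \<le> t" for t
    using that s by (subst less_rearr01_iff) (auto simp: D ennreal_less_one_iff)
  show "rearr01 (\<lambda>_. 1) s = 1"
    by (rule ennreal_eq_if_real_less) (rule iff)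
qed

text \<open>Strict superlevel sets commute with increasing limits: t lies below a supremum iff it
  lies below some member. Monotone convergence of the indicators carries this to distribution
  functions, and \<open>less_rearr01_iff\<close> to rearrangements.\<close>

lemma rearr01_SUP:
  fixes F :: "nat \<Rightarrow> real \<Rightarrow> ennreal"
  assumes F: "\<And>j. F j \<in> M_plus" and f: "f \<in> M_plus"
    and lim: "AE s in I01. incseq (\<lambda>j. F j s) \<and> (\<lambda>j. F j s) \<longlonglongrightarrow> f s"
  shows "incseq (\<lambda>j. rearr01 (F j) s)" "rearr01 f s = (SUP j. rearr01 (F j) s)"
proof -
  show "incseq (\<lambda>j. rearr01 (F j) s)"
    using lim by (intro incseq_SucI rearr01_mono_AE F)
      (auto elim!: eventually_mono simp: incseq_Suc_iff)
  have SUP: "AE x in I01. f x = (SUP j. F j x)"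
    using lim by eventually_elim (auto dest!: LIMSEQ_SUP intro: LIMSEQ_unique)
  have inc: "AE x in I01. F i x \<le> F (Suc i) x" for i
    using lim by (auto elim!: eventually_mono simp: incseq_Suc_iff)
  have D: "distr01 f t = (SUP j. distr01 (F j) t)" for t
  proof -
    have "distr01 f t = (\<integral>\<^sup>+x. indicator {x \<in> space I01. t < f x} x \<partial>I01)"
      unfolding distr01_def using f by (intro nn_integral_indicator[symmetric]) measurable
    also have "\<dots> = (\<integral>\<^sup>+x. (SUP j. indicator {x \<in> space I01. t < F j x} x) \<partial>I01)"
    proof (rule nn_integral_cong_AE, use SUP in eventually_elim)
      fix x assume x: "f x = (SUP j. F j x)"
      show "indicator {x \<in> space I01. t < f x} x = (SUP j. indicator {x \<in> space I01. t
        < F j x} x :: ennreal)"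
      proof (cases "x \<in> space I01 \<and> t < f x")
        case True
        then obtain j where "t < F j x" unfolding x less_SUP_iff by auto
        then have "indicator {x \<in> space I01. t < F j x} x = (1::ennreal)" using True
          by (auto simp: indicator_def)
        then have "(1::ennreal) \<le> (SUP j. indicator {x \<in> space I01. t < F j x} x)"
          by (intro SUP_upper2[of j]) auto
        moreover have "(SUP j. indicator {x \<in> space I01. t < F j x} x) \<le> (1::ennreal)"
          by (intro SUP_least) (simp add: indicator_def)
        ultimately show ?thesis using True by (auto simp: indicator_def)
      next
        case False
        then have "\<not> (x \<in> space I01 \<and> t < F j x)" for j unfolding x less_SUP_iff by auto
        then have *: "indicator {x \<in> space I01. t < F j x} x = (0 :: ennreal)" for j
          by (auto simp: indicator_def)
        have "indicator {x \<in> space I01. t < f x} x = (0 :: ennreal)" using False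
          by (auto simp: indicator_def)
        then show ?thesis unfolding * by simp
      qed
    qed
    also have "\<dots> = (SUP j. \<integral>\<^sup>+x. indicator {x \<in> space I01. t < F j x} x \<partial>I01)"
    proof (rule nn_integral_monotone_convergence_SUP_AE[of "\<lambda>j x. indicator {x \<in> space I01. t
      < F j x} x"])
      show "AE x in I01. indicator {x \<in> space I01. t < F i x} x \<le> (indicator {x \<in> space I01. t
        < F (Suc i) x} x :: ennreal)" for i
        using inc[of i] by eventually_elim (auto simp: indicator_def)
      show "(\<lambda>x. indicator {x \<in> space I01. t < F i x} x) \<in> M_plus" for i
        using F[of i] by measurable
    qed
    also have "\<dots> = (SUP j. distr01 (F j) t)"
      unfolding distr01_def using F by (intro SUP_cong refl nn_integral_indicator) measurable
    finally show ?thesis .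
  qed
  have iff: "ennreal t < rearr01 f s \<longleftrightarrow> ennreal t < (SUP j. rearr01 (F j) s)" if "0 \<le> t" for t
    using that by (simp add: less_rearr01_iff F f D less_SUP_iff)
  show "rearr01 f s = (SUP j. rearr01 (F j) s)"
    by (rule ennreal_eq_if_real_less) (rule iff)
qed

section \<open>Layer-cake formula, the Hardy-Littlewood inequality and Hardy's lemma\<close>

lemma nn_integral_layers:
  assumes M: "sigma_finite_measure M" and [measurable]: "f \<in> borel_measurable M"
    "g \<in> borel_measurable M"
  shows "(\<integral>\<^sup>+x. f x * g x \<partial>M) =
    (\<integral>\<^sup>+b. indicator {0..} b * (\<integral>\<^sup>+x. indicator {x \<in> space M. ennreal b < g x} x * f x \<partial>M) \<partial>lborel)"
proof -
  interpret sigma_finite_measure M by fact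
  interpret pair_sigma_finite lborel M by (intro pair_sigma_finite.intro sigma_finite_lborel M)
  \<comment> \<open>A value is the length of the set of nonnegative levels below it; the value
    \<open>top\<close> corresponds to the infinite length of the half-line.\<close>
  have layer: "(\<integral>\<^sup>+a. (if 0 \<le> a \<and> ennreal a < y then 1 else 0) \<partial>lborel) = y" for y :: ennreal
  proof (cases y)
    case (real r)
    have "(\<integral>\<^sup>+a. (if 0 \<le> a \<and> ennreal a < y then 1 else 0) \<partial>lborel)
      = (\<integral>\<^sup>+a. indicator {0..<r} a \<partial>lborel)"
      using real by (intro nn_integral_cong) (auto simp: ennreal_less_iff indicator_def)
    then show ?thesis using real by (simp add: emeasure_lborel_Ico)
  next
    case top
    have "(\<integral>\<^sup>+a. (if 0 \<le> a \<and> ennreal a < y then 1 else 0) \<partial>lborel)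
      = (\<integral>\<^sup>+a. indicator {0::real..} a \<partial>lborel)"
      using top by (intro nn_integral_cong) (auto simp: indicator_def)
    also have "\<dots> = top"
    proof (rule ccontr)
      assume "(\<integral>\<^sup>+a. indicator {0::real..} a \<partial>lborel) \<noteq> top"
      then obtain r where r: "emeasure lborel {0::real..} = ennreal r" "0 \<le> r" by (cases
        "emeasure lborel {0::real..}") auto
      have "emeasure lborel {0..r + 1} \<le> emeasure lborel {0::real..}" by (rule emeasure_mono) auto
      then show False using r by simp
    qed
    finally show ?thesis using top by simp
  qed
  have "(\<integral>\<^sup>+x. f x * g x \<partial>M) = (\<integral>\<^sup>+x. (\<integral>\<^sup>+b. f x * (if 0 \<le> b \<and> ennreal b
    < g x then 1 else 0) \<partial>lborel) \<partial>M)"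
    by (simp add: nn_integral_cmult layer)
  also have "\<dots> = (\<integral>\<^sup>+b. (\<integral>\<^sup>+x. f x * (if 0 \<le> b \<and> ennreal b < g x then 1 else 0) \<partial>M) \<partial>lborel)"
    by (rule Fubini') measurable
  also have "\<dots> = (\<integral>\<^sup>+b. (\<integral>\<^sup>+x. indicator {0..} b * (indicator {x \<in> space M. ennreal b < g x} x
    * f x) \<partial>M) \<partial>lborel)"
    by (intro nn_integral_cong) (auto simp: indicator_def)
  also have "\<dots> = (\<integral>\<^sup>+b. indicator {0..} b * (\<integral>\<^sup>+x. indicator {x \<in> space M. ennreal b < g x} x
    * f x \<partial>M) \<partial>lborel)"
    by (intro nn_integral_cong nn_integral_cmult) measurable
  finally show ?thesis .
qed

text \<open>Slicing both factors leaves only the measures of joint superlevel sets, so two such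
  integrals can be compared level by level.\<close>

lemma nn_integral_prod_layers:
  assumes M: "sigma_finite_measure M" and [measurable]: "f \<in> borel_measurable M"
    "g \<in> borel_measurable M"
  shows "(\<integral>\<^sup>+x. f x * g x \<partial>M) =
    (\<integral>\<^sup>+b. indicator {0..} b * (\<integral>\<^sup>+a. indicator {0..} a *
       emeasure M {x \<in> space M. ennreal a < f x \<and> ennreal b < g x} \<partial>lborel) \<partial>lborel)"
proof -
  have "(\<integral>\<^sup>+x. indicator {x \<in> space M. ennreal b < g x} x * f x \<partial>M) = (\<integral>\<^sup>+a. indicator {0..} a *
       emeasure M {x \<in> space M. ennreal a < f x \<and> ennreal b < g x} \<partial>lborel)" for b
  proof -
    have "(\<integral>\<^sup>+x. indicator {x \<in> space M. ennreal b < g x} x * f x \<partial>M) = (\<integral>\<^sup>+a. indicator {0..} a *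
        (\<integral>\<^sup>+x. indicator {x \<in> space M. ennreal a < f x} x * indicator {x \<in> space M. ennreal b < g x}
          x \<partial>M) \<partial>lborel)"
      by (rule nn_integral_layers[OF M]) measurable
    also have "\<dots> = (\<integral>\<^sup>+a. indicator {0..} a *
        (\<integral>\<^sup>+x. indicator {x \<in> space M. ennreal a < f x \<and> ennreal b < g x} x \<partial>M) \<partial>lborel)"
      by (intro nn_integral_cong arg_cong2[where f="(*)"] refl) (auto simp: indicator_def)
    also have "\<dots> = (\<integral>\<^sup>+a. indicator {0..} a * emeasure M {x \<in> space M. ennreal a < f x \<and> ennreal b
      < g x} \<partial>lborel)"
      by (intro nn_integral_cong arg_cong2[where f="(*)"] refl nn_integral_indicator) measurable
    finally show ?thesis .
  qed
  then show ?thesis by (simp only: nn_integral_layers[OF assms])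
qed

lemma finite_I01: "finite_measure I01"
  using emeasure_I01_le_1[of "space I01"] by (intro finite_measureI) (auto simp: top_unique)

lemma sigma_finite_I01: "sigma_finite_measure I01"
  using finite_I01 by (simp add: finite_measure_def)

text \<open>For each pair of levels the joint superlevel set has measure at most the smaller of the
  two distribution functions, and the rearrangements attain this bound.\<close>

lemma hardy_littlewood:
  assumes f: "f \<in> M_plus" and g: "g \<in> M_plus"
  shows "(\<integral>\<^sup>+x. f x * g x \<partial>I01) \<le> (\<integral>\<^sup>+x. rearr01 f x * rearr01 g x \<partial>I01)"
proof -
  have "emeasure I01 {x \<in> space I01. ennreal a < f x \<and> ennreal b < g x}
      \<le> emeasure I01 {x \<in> space I01. ennreal a < rearr01 f x \<and> ennreal b < rearr01 g x}"
    if ab: "0 \<le> a" "0 \<le> b" for a b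
  proof -
    have "emeasure I01 {x \<in> space I01. ennreal a < f x \<and> ennreal b < g x}
      \<le> min (distr01 f (ennreal a)) (distr01 g (ennreal b))"
      unfolding distr01_def using f g
        by (intro min.boundedI emeasure_mono) (auto simp: sets_level_I01)
    also have "\<dots> = min (distr01 (rearr01 f) (ennreal a)) (distr01 (rearr01 g) (ennreal b))"
      using f g ab by (simp add: distr01_rearr01)
    also have "\<dots> \<le> emeasure I01 {x \<in> space I01. ennreal a < rearr01 f x \<and> ennreal b < rearr01 g x}"
    proof -
      \<comment> \<open>Superlevel sets of two decreasing functions are nested, so their
        intersection is one of them.\<close>
      have "(\<forall>x. ennreal a < rearr01 f x \<longrightarrow> ennreal b < rearr01 g x) \<or> (\<forall>x. ennreal b
        < rearr01 g x \<longrightarrow> ennreal a < rearr01 f x)"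
        by (metis less_le_trans linear rearr_antimono)
      then have "{x \<in> space I01. ennreal a < rearr01 f x} = {x \<in> space I01. ennreal a < rearr01 f x
        \<and> ennreal b < rearr01 g x}
         \<or> {x \<in> space I01. ennreal b < rearr01 g x} = {x \<in> space I01. ennreal a < rearr01 f x \<and>
           ennreal b < rearr01 g x}"
        by blast
      then show ?thesis unfolding distr01_def
        by (elim disjE) (simp_all only: min.cobounded1 min.cobounded2)
    qed
    finally show ?thesis .
  qed
  then show ?thesis
    using f g sigma_finite_I01
    by (auto simp: nn_integral_prod_layers indicator_def simp del: space_restrict_space intro!:
      nn_integral_mono)
qed

text \<open>The superlevel sets of \<open>rearr01 f\<close> are initial intervals, so the hypothesis
  applies to each layer, and integrating over the levels gives the claim.\<close>

lemma hardy_lemma: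
  assumes a: "a \<in> M_plus" and b: "b \<in> M_plus" and f: "f \<in> M_plus"
    and le: "\<And>s. 0 < s \<Longrightarrow> s \<le> 1 \<Longrightarrow>
      (\<integral>\<^sup>+x. indicator {0<..<s} x * a x \<partial>I01) \<le> C * (\<integral>\<^sup>+x. indicator {0<..<s} x * b x \<partial>I01)"
  shows "(\<integral>\<^sup>+x. a x * rearr01 f x \<partial>I01) \<le> C * (\<integral>\<^sup>+x. b x * rearr01 f x \<partial>I01)"
proof -
  have "(\<integral>\<^sup>+x. indicator {x \<in> space I01. ennreal t < rearr01 f x} x * a x \<partial>I01)
     \<le> (\<integral>\<^sup>+x. indicator {x \<in> space I01. ennreal t < rearr01 f x} x *
       (C * b x) \<partial>I01)" if t: "0 \<le> t" for t
  proof -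
    obtain d where d: "0 \<le> d" "d \<le> 1" "distr01 f (ennreal t) = ennreal d"
      "{r \<in> space I01. ennreal t < rearr01 f r} = {0<..<d}"
      by (rule level_rearr01[OF f t]) (rule that)
    have "(\<integral>\<^sup>+x. indicator {0<..<d} x * (C * b x) \<partial>I01) = (\<integral>\<^sup>+x. C * (indicator {0<..<d} x
      * b x) \<partial>I01)"
      by (simp add: ac_simps)
    also have "\<dots> = C * (\<integral>\<^sup>+x. indicator {0<..<d} x * b x \<partial>I01)"
    proof (rule nn_integral_cmult)
      have "indicator {0<..<d} \<in> M_plus" by (rule borel_imp_M_plus) simp
      then show "(\<lambda>x. indicator {0<..<d} x * b x) \<in> M_plus" using b by measurable
    qed
    \<comment> \<open>The hypothesis covers positive lengths; a layer of length 0 is empty.\<close>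
    finally show ?thesis unfolding d(4) using le[of d] d(1,2) by (cases "d = 0") auto
  qed
  then have "(\<integral>\<^sup>+x. a x * rearr01 f x \<partial>I01) \<le> (\<integral>\<^sup>+x. (C * b x) * rearr01 f x \<partial>I01)"
    using a b by (subst (1 2) nn_integral_layers[OF sigma_finite_I01])
      (auto simp: indicator_def[of "{0..}"] simp del: space_restrict_space intro!: nn_integral_mono)
  also have "\<dots> = C * (\<integral>\<^sup>+x. b x * rearr01 f x \<partial>I01)"
    using b by (simp add: mult.assoc nn_integral_cmult)
  finally show ?thesis .
qed

section \<open>Measure-preserving maps that realise the rearrangement\<close>

lemma borel_on_I01:
  assumes "A \<in> sets borel" shows "A \<inter> {0<..<1} \<in> sets I01"
proof -
  have "A \<inter> {0<..<1} \<in> sets borel" using assms by (intro sets.Int) auto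
  then show ?thesis by (subst sets_restrict_space_iff) auto
qed

text \<open>A map as in Ryff's theorem: order the interval by \<open>g\<close> decreasingly, breaking ties by position,
  and send \<open>x\<close> to the measure of the set of its predecessors.\<close>

lemma exists_rearranging_map:
  assumes g [measurable]: "g \<in> M_plus"
  obtains \<tau> :: "real \<Rightarrow> real" where "\<tau> \<in> borel_measurable I01"
    "\<And>w. w \<in> borel_measurable borel \<Longrightarrow> (\<integral>\<^sup>+x. w (\<tau> x) \<partial>I01) = (\<integral>\<^sup>+x. w x \<partial>I01)"
    "\<And>x. rearr01 g (\<tau> x) \<le> g x"
proof -
  interpret finite_measure I01 by (rule finite_I01)
  have id [measurable]: "(\<lambda>x. x) \<in> borel_measurable I01"
    by (intro measurable_restrict_space1 measurable_completion) simp
  define E where "E x = {y \<in> space I01. g x < g y \<or> (g x = g y \<and> y < x)}" for x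
  define \<tau> where "\<tau> x = measure I01 (E x)" for x
  have E [measurable]: "E x \<in> sets I01" for x unfolding E_def by measurable
  have \<tau>: "emeasure I01 (E x) = ennreal (\<tau> x)" for x
    by (simp add: \<tau>_def emeasure_eq_measure)
  have \<tau>_le: "\<tau> x \<le> 1" for x
    using emeasure_I01_le_1[of "E x"] unfolding \<tau> by simp
  have \<tau>_ge: "0 \<le> \<tau> x" for x by (simp add: \<tau>_def)
  \<comment> \<open>Every mass s below 1 is cut off by an initial segment S of the order:
    predecessors of points of S lie in S, and a point outside S has all of S before it.\<close>
  have ex: "\<exists>S \<in> sets I01. emeasure I01 S = ennreal s \<and> (\<forall>x\<in>S. E x \<subseteq> S) \<and> (\<forall>x \<in> space I01 - S. S
    \<subseteq> E x)"
    if s: "0 \<le> s" "s < 1" for s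
  proof -
    \<comment> \<open>The cut falls into the level t = g*(s): the part above t has mass at most s,
      and with the ties \<open>B\<close> added at least s. The missing mass is taken from the left
      part of \<open>B\<close>.\<close>
    define t where "t = rearr01 g s"
    define B where "B = {x \<in> space I01. g x = t}"
    define G where "G = {x \<in> space I01. t < g x}"
    have BG [measurable]: "B \<in> sets I01" "G \<in> sets I01" unfolding B_def G_def by measurable
    have disj: "B \<inter> G = {}" by (auto simp: B_def G_def)
    have lower: "emeasure I01 G \<le> ennreal s"
    proof (cases t)
      case (real r)
      then show ?thesis using less_rearr01_iff[OF g, of r s] by (simp add: t_def distr01_def G_def)
    next
      case top then show ?thesis by (simp add: G_def)
    qed
    have upper: "ennreal s \<le> emeasure I01 (B \<union> G)"
    proof (cases "t = 0")
      case True
      then have "B \<union> G = {0<..<1}" by (auto simp: B_def G_def)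
      then show ?thesis using s emeasure_I01_interval[of 0 1] by simp
    next
      case False
      then have "0 < t" by (simp add: zero_less_iff_neq_zero)
      then obtain v :: "nat \<Rightarrow> ennreal" where v: "\<And>i. v i < t" "v \<longlonglongrightarrow> t"
        using approx_from_below_dense_linorder by blast
      \<comment> \<open>Running maxima make the approximating levels increasing, so that the sets
        \<open>A i\<close> decrease and continuity from above applies.\<close>
      define u where "u i = Max (v ` {..i})" for i
      have u1: "incseq u" unfolding u_def incseq_def by (auto intro: Max_mono)
      have u2: "u i < t" for i unfolding u_def using v(1) by simp
      have u3: "u \<longlonglongrightarrow> t"
      proof (rule tendsto_sandwich[OF _ _ v(2) tendsto_const])
        show "\<forall>\<^sub>F i in sequentially. v i \<le> u i" by (simp add: u_def)
        show "\<forall>\<^sub>F i in sequentially. u i \<le> t" by (simp add: u2 less_imp_le)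
      qed
      note u = u1 u2 u3
      define A where "A i = {x \<in> space I01. u i < g x}" for i
      have A [measurable]: "A i \<in> sets I01" for i unfolding A_def by measurable
      have "B \<union> G = (\<Inter>i. A i)"
      proof safe
        fix x i assume "x \<in> B" then show "x \<in> A i" using u(2)[of i] by (auto simp: A_def B_def)
      next
        fix x i assume "x \<in> G" then show "x \<in> A i" using less_trans[OF u(2)[of i]]
          by (auto simp: A_def G_def)
      next
        fix x assume x: "x \<in> (\<Inter>i. A i)" "x \<notin> G"
        then have "t \<le> g x" by (intro LIMSEQ_le_const2[OF u(3)])
          (auto simp: A_def intro: less_imp_le)
        with x show "x \<in> B" by (auto simp: B_def A_def G_def)
      qed
      moreover have "decseq A" using u(1)
        by (auto simp: decseq_def A_def incseq_def intro: le_less_trans)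
      ultimately have "emeasure I01 (B \<union> G) = (INF i. emeasure I01 (A i))"
        using INF_emeasure_decseq[of A I01] A by (simp add: image_subset_iff)
      moreover have "ennreal s \<le> emeasure I01 (A i)" for i
      proof -
        obtain r where r: "u i = ennreal r" "0 \<le> r" using u(2)[of i] by (cases "u i") auto
        show ?thesis using u(2)[of i] less_rearr01_iff[OF g r(2), of s]
          by (simp add: t_def r(1) distr01_def A_def)
      qed
      ultimately show ?thesis by (auto intro: INF_greatest)
    qed
    \<comment> \<open>The mass of ties up to position c is 1-Lipschitz in c, so the intermediate
      value theorem yields a cut position of exactly the missing mass.\<close>
    define F where "F c = measure I01 (B \<inter> {..c})" for c
    have Bc [measurable]: "B \<inter> {..c} \<in> sets I01" for c
    proof -
      have "B \<inter> {..c} = B \<inter> ({..c} \<inter> {0<..<1})" by (auto simp: B_def)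
      then show ?thesis using borel_on_I01[of "{..c}"] BG by (metis atMost_borel sets.Int)
    qed
    have F_diff: "F d \<le> F c + (d - c)" if cd: "c \<le> d" for c d
    proof -
      have "{c<..d} \<inter> {0<..<1} \<in> sets I01" by (rule borel_on_I01) simp
      note [measurable] = this
      have "emeasure I01 ({c<..d} \<inter> {0<..<1}) \<le> ennreal (d - c)"
      proof -
        have "emeasure I01 ({c<..d} \<inter> {0<..<1}) \<le> emeasure lebesgue {c<..d}"
          by (subst emeasure_I01) (auto intro!: emeasure_mono)
        then show ?thesis using cd by simp
      qed
      then have *: "measure I01 ({c<..d} \<inter> {0<..<1}) \<le> d - c" using cd
        by (simp add: emeasure_eq_measure)
      have "F d \<le> measure I01 ((B \<inter> {..c}) \<union> ({c<..d} \<inter> {0<..<1}))"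
        unfolding F_def
      proof (rule finite_measure_mono)
        show "B \<inter> {..d} \<subseteq> (B \<inter> {..c}) \<union> ({c<..d} \<inter> {0<..<1})" by (auto simp: B_def)
      qed measurable
      also have "\<dots> \<le> F c + measure I01 ({c<..d} \<inter> {0<..<1})"
        unfolding F_def by (rule measure_Un_le) measurable
      finally show ?thesis using * by simp
    qed
    have F_mono: "F c \<le> F d" if "c \<le> d" for c d
      unfolding F_def using that by (intro finite_measure_mono) auto
    have lip: "dist (F c) (F d) \<le> 1 * dist c d" for c d
      using F_diff[of c d] F_diff[of d c] F_mono[of c d] F_mono[of d c] by (cases "c
        \<le> d") (auto simp: dist_real_def)
    have cont: "continuous_on {0..1} F"
      by (rule lipschitz_on_continuous_on[of 1]) (auto intro!: lipschitz_onI lip simp del: mult_1)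
    have F0: "F 0 = 0"
    proof -
      have "B \<inter> {..0} = {}" by (auto simp: B_def)
      then show ?thesis by (simp add: F_def)
    qed
    have F1: "F 1 = measure I01 B"
    proof -
      have "B \<inter> {..1} = B" by (auto simp: B_def)
      then show ?thesis by (simp add: F_def)
    qed
    have "measure I01 G \<le> s" "s \<le> measure I01 B + measure I01 G"
      using lower upper s disj finite_measure_Union[of B G]
        by (auto simp: emeasure_eq_measure simp flip: ennreal_plus)
    then obtain c where c: "0 \<le> c" "c \<le> 1" "F c = s - measure I01 G"
      using IVT'[of F 0 "s - measure I01 G" 1] cont F0 F1 by auto
    define S where "S = (B \<inter> {..c}) \<union> G"
    have "measure I01 S = s"
      using finite_measure_Union[of "B \<inter> {..c}" G] disj c(3) by (auto simp: S_def F_def)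
    then have "emeasure I01 S = ennreal s" by (simp add: emeasure_eq_measure)
    moreover have "S \<in> sets I01" unfolding S_def by measurable
    moreover have "\<forall>x\<in>S. E x \<subseteq> S"
      unfolding S_def E_def B_def G_def by (auto intro: less_trans)
    moreover have "\<forall>x \<in> space I01 - S. S \<subseteq> E x"
      unfolding S_def E_def B_def G_def
        by (auto simp: not_less intro: le_less_trans order.not_eq_order_implies_strict)
    ultimately show ?thesis by blast
  qed
  define S where "S s = (SOME S. S \<in> sets I01 \<and> emeasure I01 S = ennreal s \<and> (\<forall>x\<in>S. E x \<subseteq> S)
      \<and> (\<forall>x \<in> space I01 - S. S \<subseteq> E x))" for s
  have "S s \<in> sets I01 \<and> emeasure I01 (S s) = ennreal s \<and> (\<forall>x\<in>S s. E x \<subseteq> S s)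
      \<and> (\<forall>x \<in> space I01 - S s. S s \<subseteq> E x)" if "0 \<le> s" "s < 1" for s
    unfolding S_def by (rule someI_ex) (use ex[OF that] in \<open>simp only: Bex_def\<close>)
  then have S: "\<And>s. 0 \<le> s \<Longrightarrow> s < 1 \<Longrightarrow> S s \<in> sets I01"
    "\<And>s. 0 \<le> s \<Longrightarrow> s < 1 \<Longrightarrow> emeasure I01 (S s) = ennreal s"
    "\<And>s x. 0 \<le> s \<Longrightarrow> s < 1 \<Longrightarrow> x \<in> S s \<Longrightarrow> E x \<subseteq> S s"
    "\<And>s x. 0 \<le> s \<Longrightarrow> s < 1 \<Longrightarrow> x \<in> space I01 - S s \<Longrightarrow> S s \<subseteq> E x" by simp_all
  have S_le: "\<tau> x \<le> s" if "0 \<le> s" "s < 1" "x \<in> S s" for s x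
    using emeasure_mono[OF S(3)[OF that] S(1)[OF that(1,2)]] S(2)[OF that(1,2)] that \<tau>[of x] by simp
  have S_ge: "s \<le> \<tau> x" if "0 \<le> s" "s < 1" "x \<in> space I01 - S s" for s x
    using emeasure_mono[OF S(4)[OF that] E] S(2)[OF that(1,2)] that \<tau>[of x] \<tau>_ge[of x] by simp
  \<comment> \<open>Masses strictly between s and 1 that decrease to s; the offset in n + 2 keeps
    even the first one below 1.\<close>
  define q where "q = (\<lambda>(s::real) n. s + (1 - s) / real (n + 2))"
  have q: "s < q s n" "q s n < 1" if "s < 1" for s n
  proof -
    have "(1 - s) / real (n + 2) < (1 - s) / 1"
      using that by (intro divide_strict_left_mono) auto
    then show "s < q s n" "q s n < 1" using that by (auto simp: q_def)
  qed
  have q_lim: "q s \<longlonglongrightarrow> s" for s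
  proof -
    have "(\<lambda>n. (1 - s) / real (n + 2)) \<longlonglongrightarrow> 0"
      by (rule LIMSEQ_ignore_initial_segment) (rule lim_const_over_n)
    from tendsto_add[OF tendsto_const[of s] this] show ?thesis by (simp add: q_def)
  qed
  \<comment> \<open>\<open>S s\<close> itself may miss points with \<open>\<tau> x = s\<close>,
    since outside it only \<open>s \<le> \<tau> x\<close> is known. Intersecting slightly larger
    segments gives the level set exactly, hence its measurability and its measure.\<close>
  have level: "{x \<in> space I01. \<tau> x \<le> s} = (\<Inter>n. S (q s n))" if s: "0 \<le> s" "s < 1" for s
  proof safe
    fix x n assume x: "x \<in> space I01" "\<tau> x \<le> s"
    show "x \<in> S (q s n)"
    proof (rule ccontr)
      assume "x \<notin> S (q s n)"
      then have "q s n \<le> \<tau> x" using q[of s n] s x by (intro S_ge) auto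
      then show False using q[of s n] s x by simp
    qed
  next
    fix x assume x: "x \<in> (\<Inter>n. S (q s n))"
    then show "x \<in> space I01" using S(1)[of "q s 0"] q[of s 0] s sets.sets_into_space by fastforce
    have "\<tau> x \<le> q s n" for n using x q[of s n] s by (intro S_le) auto
    then show "\<tau> x \<le> s" by (intro LIMSEQ_le_const[OF q_lim[of s]]) auto
  qed
  have level_sets: "{x \<in> space I01. \<tau> x \<le> s} \<in> sets I01" for s
  proof -
    consider "s < 0" | "0 \<le> s" "s < 1" | "1 \<le> s" by linarith
    then show ?thesis
    proof cases
      case 1
      then have "{x \<in> space I01. \<tau> x \<le> s} = {}" using \<tau>_ge
        by (auto simp: not_le intro: less_le_trans)
      then show ?thesis by (simp only: sets.empty_sets)
    next
      case 2
      have "S (q s n) \<in> sets I01" for n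
        using q[of s n] 2 by (intro S(1)) auto
      then show ?thesis unfolding level[OF 2] by (intro sets.countable_INT) auto
    next
      case 3
      then have "{x \<in> space I01. \<tau> x \<le> s} = space I01" using \<tau>_le by (auto intro: order_trans)
      then show ?thesis by (metis sets.top)
    qed
  qed
  have meas: "\<tau> \<in> borel_measurable I01"
    by (rule borel_measurableI_le) (rule level_sets)
  have level_emeasure: "emeasure I01 {x \<in> space I01. \<tau> x \<le> s} = ennreal s" if s: "0 \<le> s" "s
    < 1" for s
  proof (rule antisym)
    have "emeasure I01 {x \<in> space I01. \<tau> x \<le> s} \<le> ennreal (q s n)" for n
    proof -
      have "emeasure I01 {x \<in> space I01. \<tau> x \<le> s} \<le> emeasure I01 (S (q s n))"
        using q[of s n] s level[OF s] by (intro emeasure_mono S(1)) auto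
      then show ?thesis using S(2)[of "q s n"] q[of s n] s by simp
    qed
    then show "emeasure I01 {x \<in> space I01. \<tau> x \<le> s} \<le> ennreal s"
      by (intro LIMSEQ_le_const[OF tendsto_ennrealI[OF q_lim]]) auto
    have "S s \<subseteq> {x \<in> space I01. \<tau> x \<le> s}"
      using S_le[OF s] sets.sets_into_space[OF S(1)[OF s]] by auto
    then have "emeasure I01 (S s) \<le> emeasure I01 {x \<in> space I01. \<tau> x \<le> s}"
      by (rule emeasure_mono) (rule level_sets)
    then show "ennreal s \<le> emeasure I01 {x \<in> space I01. \<tau> x \<le> s}" using S(2)[OF s] by simp
  qed
  have level': "emeasure I01 {x \<in> space I01. \<tau> x \<le> s} = emeasure I01 {x \<in> space I01. x \<le> s}" for s
  proof -
    consider "s < 0" | "0 \<le> s" "s < 1" | "1 \<le> s" by linarith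
    then show ?thesis
    proof cases
      case 1
      then have "{x \<in> space I01. \<tau> x \<le> s} = {}" "{x \<in> space I01. x \<le> s} = {}"
        using \<tau>_ge by (auto simp: not_le intro: less_le_trans)
      then show ?thesis by (simp only:)
    next
      case 2
      have "{x \<in> space I01. x \<le> s} = {0<..s}" using 2 by auto
      moreover have "emeasure I01 {0<..s} = ennreal s"
        using 2 by (subst emeasure_restrict_space) auto
      ultimately show ?thesis using level_emeasure[OF 2] by simp
    next
      case 3
      then have "{x \<in> space I01. \<tau> x \<le> s} = {x \<in> space I01. x \<le> s}" using \<tau>_le
        by (auto intro: order_trans)
      then show ?thesis by simp
    qed
  qed
  \<comment> \<open>The image of \<open>I01\<close> under \<open>\<tau>\<close> is again the uniform
    distribution, because the distribution functions agree at every s.\<close>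
  have dist_eq: "distr I01 borel \<tau> = distr I01 borel (\<lambda>x. x)"
  proof (rule measure_eqI_lessThan)
    fix c :: real
    have compl: "emeasure (distr I01 borel h) {c<..} = emeasure I01 (space I01)
      - emeasure I01 {x \<in> space I01. h x \<le> c}"
      if h: "h \<in> borel_measurable I01" for h :: "real \<Rightarrow> real"
    proof -
      have "h -` {c<..} \<inter> space I01 = space I01 - {x \<in> space I01. h x \<le> c}" by auto
      moreover have "{x \<in> space I01. h x \<le> c} \<in> sets I01" using h by measurable
      moreover have "emeasure (distr I01 borel h) {c<..} = emeasure I01 (h -` {c<..} \<inter> space I01)"
        using h by (intro emeasure_distr) auto
      moreover have "emeasure I01 (space I01 - {x \<in> space I01. h x \<le> c}) = emeasure I01 (space I01)
        - emeasure I01 {x \<in> space I01. h x \<le> c}"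
        by (rule emeasure_compl) (fact, simp)
      ultimately show ?thesis by (simp only:)
    qed
    show "emeasure (distr I01 borel \<tau>) {c<..} = emeasure (distr I01 borel (\<lambda>x. x)) {c<..}"
      unfolding compl[OF meas] compl[OF id] level' ..
    show "emeasure (distr I01 borel \<tau>) {c<..} < \<infinity>"
      by (subst emeasure_distr) (use meas in \<open>auto simp: less_top[symmetric]\<close>)
  qed auto
  show thesis
  proof
    show "\<tau> \<in> borel_measurable I01" by fact
    show "(\<integral>\<^sup>+x. w (\<tau> x) \<partial>I01) = (\<integral>\<^sup>+x. w x \<partial>I01)" if w: "w \<in> borel_measurable borel" for w
      using nn_integral_distr[of \<tau> I01 borel w] nn_integral_distr[of
        "\<lambda>x. x" I01 borel w] meas id w dist_eq by simp
    show "rearr01 g (\<tau> x) \<le> g x" for x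
    proof (rule ennreal_le_if_real_less)
      fix t :: real assume t: "0 \<le> t" "ennreal t < rearr01 g (\<tau> x)"
      then have less: "emeasure I01 (E x) < distr01 g (ennreal t)"
        using less_rearr01_iff[OF g t(1)] \<tau> by simp
      \<comment> \<open>If g x < t, all points where g exceeds t precede x, so their mass is at most
        \<open>\<tau> x\<close>, contradicting \<open>less\<close>. This one inequality suffices
        later, since \<open>hardy_littlewood\<close> supplies the reverse estimates.\<close>
      show "ennreal t \<le> g x"
      proof (rule ccontr)
        assume "\<not> ennreal t \<le> g x"
        then have "{y \<in> space I01. ennreal t < g y} \<subseteq> E x"
          by (auto simp: E_def not_le intro: less_trans)
        then have "distr01 g (ennreal t) \<le> emeasure I01 (E x)"
          unfolding distr01_def by (rule emeasure_mono) (rule E)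
        with less show False by simp
      qed
    qed
  qed
qed

section \<open>Associate norms\<close>

lemma ri_zero:
  assumes "ri_function_norm N" "f \<in> M_plus" shows "N f = 0 \<longleftrightarrow> (AE s in I01. f s = 0)"
  using assms(1)[unfolded ri_function_norm_def, THEN conjunct1] assms(2) by (rule bspec)

lemma ri_scale:
  assumes "ri_function_norm N" "f \<in> M_plus" "0 \<le> c"
  shows "N (\<lambda>s. ennreal c * f s) = ennreal c * N f"
  using assms(1)[unfolded ri_function_norm_def, THEN conjunct2, THEN conjunct1] assms(2,3) by simp

lemma ri_triangle:
  assumes "ri_function_norm N" "f \<in> M_plus" "g \<in> M_plus"
  shows "N (\<lambda>s. f s + g s) \<le> N f + N g"
  using assms(1)[unfolded ri_function_norm_def, THEN conjunct2, THEN conjunct2, THEN conjunct1]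
    assms(2,3) by simp

lemma ri_mono:
  assumes "ri_function_norm N" "f \<in> M_plus" "g \<in> M_plus" "AE s in I01. f s \<le> g s"
  shows "N f \<le> N g"
  using assms(1)[unfolded ri_function_norm_def, THEN conjunct2, THEN conjunct2, THEN conjunct2, THEN
    conjunct1] assms(2-) by simp

lemma ri_fatou:
  assumes "ri_function_norm N" "\<And>j. F j \<in> M_plus" "f \<in> M_plus"
    and "AE s in I01. incseq (\<lambda>j. F j s) \<and> (\<lambda>j. F j s) \<longlonglongrightarrow> f s"
  shows "incseq (\<lambda>j::nat. N (F j))" "(\<lambda>j. N (F j)) \<longlonglongrightarrow> N f"
  using assms(1)[unfolded ri_function_norm_def, THEN conjunct2, THEN conjunct2, THEN conjunct2, THEN
    conjunct2, THEN conjunct1, rule_format, OF assms(2-4)] by simp_all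

lemma ri_one: "ri_function_norm N \<Longrightarrow> N (\<lambda>_. 1) < top"
  unfolding ri_function_norm_def by simp

lemma ri_L1:
  assumes "ri_function_norm N"
  obtains C :: real where "0 < C" "\<And>f. f \<in> M_plus \<Longrightarrow> (\<integral>\<^sup>+ s. f s \<partial>I01) \<le> ennreal C * N f"
proof -
  obtain C :: real where C: "\<forall>f\<in>M_plus. (\<integral>\<^sup>+ s. f s \<partial>I01) \<le> ennreal C * N f"
    using assms[unfolded ri_function_norm_def, THEN conjunct2, THEN conjunct2, THEN conjunct2, THEN
      conjunct2, THEN conjunct2, THEN conjunct2, THEN conjunct1] by (rule exE)
  \<comment> \<open>The axiom provides an arbitrary real constant; enlarging it to
    \<open>max C 1\<close> keeps the bound and makes it positive.\<close>
  have "(\<integral>\<^sup>+ s. f s \<partial>I01) \<le> ennreal (max C 1) * N f" if "f \<in> M_plus" for f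
    using bspec[OF C that] by (rule order_trans) (intro mult_right_mono ennreal_leI, auto)
  moreover have "0 < max C 1" by (rule less_le_trans[OF zero_less_one max.cobounded2])
  ultimately show thesis using that by blast
qed

lemma ri_cong:
  assumes "ri_function_norm N" "f \<in> M_plus" "g \<in> M_plus" "\<And>s. s \<in> {0<..<1} \<Longrightarrow> rearr01 f s
    = rearr01 g s"
  shows "N f = N g"
  using assms(1)[unfolded ri_function_norm_def, THEN conjunct2, THEN conjunct2, THEN conjunct2, THEN
    conjunct2, THEN conjunct2, THEN conjunct2, THEN conjunct2, rule_format, OF assms(2-4)] by simp

lemma ri_rearr01:
  assumes "ri_function_norm N" "f \<in> M_plus" shows "N (rearr01 f) = N f"
  using assms by (intro ri_cong[OF assms(1)]) (auto simp: rearr01_rearr01 rearr_M_plus)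

lemma const_M_plus: "(\<lambda>_. c) \<in> M_plus" by simp

lemma ri_one_pos:
  assumes "ri_function_norm N" shows "0 < N (\<lambda>_. 1)"
proof -
  have "\<not> (AE s in I01. (1::ennreal) = 0)"
  proof
    assume "AE s in I01. (1::ennreal) = 0"
    then have "(\<integral>\<^sup>+s. 1 \<partial>I01) = 0" by (subst nn_integral_0_iff_AE) auto
    then show False using emeasure_I01_interval[of 0 1] by simp
  qed
  then show ?thesis using ri_zero[OF assms const_M_plus, of 1] by (simp add: zero_less_iff_neq_zero)
qed

lemma ri_one_real:
  assumes "ri_function_norm N"
  obtains c where "0 < c" "N (\<lambda>_. 1) = ennreal c"
  using ri_one[OF assms] ri_one_pos[OF assms] by (cases "N (\<lambda>_. 1)") auto

lemma associate_norm_upper: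
  "f \<in> M_plus \<Longrightarrow> N f \<le> 1 \<Longrightarrow> (\<integral>\<^sup>+ s. f s * g s \<partial>I01) \<le> associate_norm N g"
  unfolding associate_norm_def by (rule SUP_upper) simp

lemma associate_norm_least:
  "(\<And>f. f \<in> M_plus \<Longrightarrow> N f \<le> 1 \<Longrightarrow> (\<integral>\<^sup>+ s. f s * g s \<partial>I01) \<le> c) \<Longrightarrow> associate_norm N g \<le> c"
  unfolding associate_norm_def by (rule SUP_least) simp

text \<open>Transport f* along the map \<open>\<tau>\<close> belonging to g: v = f* o
  \<open>\<tau>\<close> is equimeasurable with f, hence in the unit ball, and g* o
  \<open>\<tau>\<close> lies below g. Measure preservation turns the integral of f* g* into one that
  is at most the integral of v g.\<close>

lemma associate_norm_ge_rearr:
  assumes N: "ri_function_norm N" and f: "f \<in> M_plus" "N f \<le> 1" and g: "g \<in> M_plus"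
  shows "(\<integral>\<^sup>+ s. rearr01 f s * rearr01 g s \<partial>I01) \<le> associate_norm N g"
proof -
  obtain \<tau> :: "real \<Rightarrow> real" where \<tau> [measurable]: "\<tau> \<in> borel_measurable I01"
    and eq: "\<And>w. w \<in> borel_measurable borel \<Longrightarrow> (\<integral>\<^sup>+x. w (\<tau> x) \<partial>I01) = (\<integral>\<^sup>+x. w x \<partial>I01)"
    and le: "\<And>x. rearr01 g (\<tau> x) \<le> g x"
    using exists_rearranging_map[OF g] by blast
  define v where "v x = rearr01 f (\<tau> x)" for x
  have v [measurable]: "v \<in> M_plus" unfolding v_def by measurable
  have "distr01 v t = distr01 (rearr01 f) t" for t
  proof -
    have *: "distr01 u t = (\<integral>\<^sup>+x. indicator {x. t < u x} x \<partial>I01)" if u: "u \<in> M_plus" for u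
    proof -
      have "distr01 u t = (\<integral>\<^sup>+x. indicator {x \<in> space I01. t < u x} x \<partial>I01)"
        unfolding distr01_def using u by (intro nn_integral_indicator[symmetric]) measurable
      also have "\<dots> = (\<integral>\<^sup>+x. indicator {x. t < u x} x \<partial>I01)"
        by (rule nn_integral_cong) (auto simp: indicator_def)
      finally show ?thesis .
    qed
    have "distr01 v t = (\<integral>\<^sup>+x. indicator {x. t < rearr01 f x} (\<tau> x) \<partial>I01)"
      by (simp add: *[OF v] v_def indicator_def)
    also have "\<dots> = distr01 (rearr01 f) t"
      unfolding *[OF rearr_M_plus] by (rule eq) measurable
    finally show ?thesis .
  qed
  then have "N v = N f"
    using f v by (subst ri_rearr01[OF N f(1), symmetric], intro ri_cong[OF N] rearr01_eq_distr
      rearr_M_plus) auto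
  have "(\<integral>\<^sup>+ s. rearr01 f s * rearr01 g s \<partial>I01) = (\<integral>\<^sup>+ s. rearr01 f (\<tau> s) * rearr01 g (\<tau> s) \<partial>I01)"
    by (rule eq[symmetric]) measurable
  also have "\<dots> \<le> (\<integral>\<^sup>+ s. v s * g s \<partial>I01)"
    unfolding v_def by (intro nn_integral_mono mult_left_mono le) simp
  also have "\<dots> \<le> associate_norm N g"
    using \<open>N v = N f\<close> f(2) by (intro associate_norm_upper v) simp
  finally show ?thesis .
qed

text \<open>Exhibits the associate norm in a form that sees only the rearrangement of g; its
  rearrangement invariance is read off from here.\<close>

lemma associate_norm_eq_rearr:
  assumes N: "ri_function_norm N" and g: "g \<in> M_plus"
  shows "associate_norm N g = (SUP f \<in> {f \<in> M_plus. N f \<le> 1}. \<integral>\<^sup>+ s. rearr01 f s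
    * rearr01 g s \<partial>I01)"
proof (rule antisym)
  show "associate_norm N g \<le> (SUP f \<in> {f \<in> M_plus. N f \<le> 1}. \<integral>\<^sup>+ s. rearr01 f s * rearr01 g s \<partial>I01)"
  proof (rule associate_norm_least)
    fix f assume f: "f \<in> M_plus" "N f \<le> 1"
    show "(\<integral>\<^sup>+ s. f s * g s \<partial>I01) \<le> (SUP f \<in> {f \<in> M_plus. N f \<le> 1}. \<integral>\<^sup>+ s. rearr01 f s
      * rearr01 g s \<partial>I01)"
      using f by (intro SUP_upper2[of f] hardy_littlewood g) auto
  qed
  show "(SUP f \<in> {f \<in> M_plus. N f \<le> 1}. \<integral>\<^sup>+ s. rearr01 f s * rearr01 g s \<partial>I01) \<le> associate_norm N g"
    using associate_norm_ge_rearr[OF N _ _ g] by (intro SUP_least) auto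
qed

lemma associate_norm_mono:
  assumes "AE s in I01. f s \<le> g s"
  shows "associate_norm N f \<le> associate_norm N g"
proof (rule associate_norm_least)
  fix h assume h: "h \<in> M_plus" "N h \<le> 1"
  have "(\<integral>\<^sup>+ s. h s * f s \<partial>I01) \<le> (\<integral>\<^sup>+ s. h s * g s \<partial>I01)"
    using assms by (intro nn_integral_mono_AE) (auto elim!: eventually_mono intro: mult_left_mono)
  also have "\<dots> \<le> associate_norm N g" by (rule associate_norm_upper[of _ N, OF h])
  finally show "(\<integral>\<^sup>+ s. h s * f s \<partial>I01) \<le> associate_norm N g" .
qed

text \<open>The constant function with value 1 / N(1) has norm 1 and is an admissible test
  function.\<close>

lemma integral_le_associate_norm:
  assumes N: "ri_function_norm N" and g: "g \<in> M_plus"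
  shows "(\<integral>\<^sup>+ s. g s \<partial>I01) \<le> N (\<lambda>_. 1) * associate_norm N g"
proof -
  obtain c where c: "0 < c" "N (\<lambda>_. 1) = ennreal c" using ri_one_real[OF N] .
  have "N (\<lambda>_. ennreal (1 / c) * 1) = ennreal (1 / c) * ennreal c"
    using c ri_scale[OF N const_M_plus, of "1 / c" 1] by simp
  also have "\<dots> = 1" using c by (simp flip: ennreal_mult)
  finally have "(\<integral>\<^sup>+ s. (ennreal (1 / c) * 1) * g s \<partial>I01) \<le> associate_norm N g"
    by (intro associate_norm_upper const_M_plus) simp
  then have "ennreal (1 / c) * (\<integral>\<^sup>+ s. g s \<partial>I01) \<le> associate_norm N g"
    using g by (simp add: nn_integral_cmult)
  then have "ennreal c * (ennreal (1 / c) * (\<integral>\<^sup>+ s. g s \<partial>I01)) \<le> ennreal c * associate_norm N g"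
    by (rule mult_left_mono) simp
  then show ?thesis using c by (simp add: mult.assoc[symmetric] flip: ennreal_mult)
qed

text \<open>The Fatou property is monotone convergence followed by an exchange of two suprema.
  Finiteness at 1 and the L^1 bound are dual to each other: each follows from the other property of
  N.\<close>

lemma ri_associate_norm:
  assumes N: "ri_function_norm N"
  shows "ri_function_norm (associate_norm N)"
  unfolding ri_function_norm_def
proof (intro conjI ballI allI impI)
  fix f assume f: "f \<in> M_plus"
  show "associate_norm N f = 0 \<longleftrightarrow> (AE s in I01. f s = 0)"
  proof
    assume "associate_norm N f = 0"
    then have "(\<integral>\<^sup>+ s. f s \<partial>I01) = 0" using integral_le_associate_norm[OF N f] by simp
    then show "AE s in I01. f s = 0" using f by (simp add: nn_integral_0_iff_AE)
  next
    assume *: "AE s in I01. f s = 0"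
    have "associate_norm N f \<le> 0"
    proof (rule associate_norm_least)
      fix h assume h: "h \<in> M_plus"
      have "(\<integral>\<^sup>+ s. h s * f s \<partial>I01) = 0"
        using h f * by (subst nn_integral_0_iff_AE) (auto elim!: eventually_mono)
      then show "(\<integral>\<^sup>+ s. h s * f s \<partial>I01) \<le> 0" by simp
    qed
    then show "associate_norm N f = 0" by simp
  qed
next
  fix f and c :: real assume f: "f \<in> M_plus"
  have "associate_norm N (\<lambda>s. ennreal c * f s) = (SUP h \<in> {h \<in> M_plus. N h \<le> 1}. ennreal c
    * (\<integral>\<^sup>+ s. h s * f s \<partial>I01))"
    unfolding associate_norm_def
  proof (intro SUP_cong refl)
    fix h assume h: "h \<in> {h \<in> M_plus. N h \<le> 1}"
    then show "(\<integral>\<^sup>+ s. h s * (ennreal c * f s) \<partial>I01) = ennreal c * (\<integral>\<^sup>+ s. h s * f s \<partial>I01)"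
      using f by (subst nn_integral_cmult[symmetric]) (auto simp: ac_simps)
  qed
  then show "associate_norm N (\<lambda>s. ennreal c * f s) = ennreal c * associate_norm N f"
    by (simp add: associate_norm_def SUP_mult_left_ennreal)
next
  fix f g assume f: "f \<in> M_plus" and g: "g \<in> M_plus"
  show "associate_norm N (\<lambda>s. f s + g s) \<le> associate_norm N f + associate_norm N g"
  proof (rule associate_norm_least)
    fix h assume h: "h \<in> M_plus" "N h \<le> 1"
    have "(\<integral>\<^sup>+ s. h s * (f s + g s) \<partial>I01) = (\<integral>\<^sup>+ s. h s * f s \<partial>I01) + (\<integral>\<^sup>+ s. h s * g s \<partial>I01)"
      using h f g by (subst nn_integral_add[symmetric]) (auto simp: distrib_left)
    also have "\<dots> \<le> associate_norm N f + associate_norm N g"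
      by (intro add_mono associate_norm_upper h)
    finally show "(\<integral>\<^sup>+ s. h s * (f s + g s) \<partial>I01) \<le> associate_norm N f + associate_norm N g" .
  qed
next
  fix f g assume "AE s in I01. f s \<le> (g s :: ennreal)"
  then show "associate_norm N f \<le> associate_norm N g" by (rule associate_norm_mono)
next
  fix F :: "nat \<Rightarrow> real \<Rightarrow> ennreal" and f
  assume F: "\<forall>j. F j \<in> M_plus" and f: "f \<in> M_plus" and
    lim: "AE s in I01. incseq (\<lambda>j. F j s) \<and> (\<lambda>j. F j s) \<longlonglongrightarrow> f s"
  show inc: "incseq (\<lambda>j. associate_norm N (F j))"
    using lim by (intro incseq_SucI associate_norm_mono)
      (auto elim!: eventually_mono simp: incseq_Suc_iff)
  have "(\<integral>\<^sup>+ s. h s * f s \<partial>I01) = (SUP j. \<integral>\<^sup>+ s. h s * F j s \<partial>I01)" if h: "h \<in> M_plus" for h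
  proof -
    have "(\<integral>\<^sup>+ s. h s * f s \<partial>I01) = (\<integral>\<^sup>+ s. (SUP j. h s * F j s) \<partial>I01)"
    proof (rule nn_integral_cong_AE, use lim in eventually_elim)
      fix s assume "incseq (\<lambda>j. F j s) \<and> (\<lambda>j. F j s) \<longlonglongrightarrow> f s"
      then have "f s = (SUP j. F j s)" using LIMSEQ_SUP LIMSEQ_unique by blast
      then show "h s * f s = (SUP j. h s * F j s)" by (simp add: SUP_mult_left_ennreal)
    qed
    also have "\<dots> = (SUP j. \<integral>\<^sup>+ s. h s * F j s \<partial>I01)"
    proof (rule nn_integral_monotone_convergence_SUP_AE)
      show "AE s in I01. h s * F j s \<le> h s * F (Suc j) s" for j
        using lim by eventually_elim (auto simp: incseq_Suc_iff intro: mult_left_mono)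
      show "(\<lambda>s. h s * F j s) \<in> M_plus" for j
        using F[rule_format, of j] h by measurable
    qed
    finally show ?thesis .
  qed
  then have "associate_norm N f = (SUP h \<in> {h \<in> M_plus. N h \<le> 1}. SUP j. \<integral>\<^sup>+ s. h s * F j s \<partial>I01)"
    unfolding associate_norm_def by (intro SUP_cong) auto
  also have "\<dots> = (SUP j. associate_norm N (F j))"
    unfolding associate_norm_def by (rule SUP_commute)
  finally show "(\<lambda>j. associate_norm N (F j)) \<longlonglongrightarrow> associate_norm N f"
    using LIMSEQ_SUP[OF inc] by simp
next
  obtain C :: real where C: "0 < C" "\<And>f. f \<in> M_plus \<Longrightarrow> (\<integral>\<^sup>+ s. f s \<partial>I01) \<le> ennreal C * N f"
    by (rule ri_L1[OF N]) (rule that)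
  have "associate_norm N (\<lambda>_. 1) \<le> ennreal C"
  proof (rule associate_norm_least)
    fix f assume f: "f \<in> M_plus" "N f \<le> 1"
    have "ennreal C * N f \<le> ennreal C * 1" by (intro mult_left_mono f) simp
    with C(2)[OF f(1)] show "(\<integral>\<^sup>+ s. f s * 1 \<partial>I01) \<le> ennreal C" by simp
  qed
  then show "associate_norm N (\<lambda>_. 1) < \<infinity>" by (simp add: le_less_trans)
next
  obtain c where c: "0 < c" "N (\<lambda>_. 1) = ennreal c" using ri_one_real[OF N] .
  then show "\<exists>C. \<forall>f\<in>M_plus. (\<integral>\<^sup>+ s. f s \<partial>I01) \<le> ennreal C * associate_norm N f"
    using integral_le_associate_norm[OF N] by (intro exI[of _ c]) auto
next
  fix f g assume fg: "f \<in> M_plus" "g \<in> M_plus" and eq: "\<forall>s\<in>{0<..<1}. rearr01 f s = rearr01 g s"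
  have "(\<integral>\<^sup>+ s. rearr01 h s * rearr01 f s \<partial>I01) = (\<integral>\<^sup>+ s. rearr01 h s * rearr01 g s \<partial>I01)" for h
    using eq by (intro nn_integral_cong) auto
  then show "associate_norm N f = associate_norm N g"
    using fg by (simp add: associate_norm_eq_rearr[OF N])
qed

text \<open>Any pairing with a is at most the pairing of rearrangements, for which
  \<open>hardy_lemma\<close> needs only initial intervals; \<open>associate_norm_ge_rearr\<close>
  leads back to b. This is the Hardy-Littlewood-Polya principle.\<close>

lemma associate_norm_le_of_integrals_le:
  assumes N: "ri_function_norm N" and a: "a \<in> M_plus" and b: "b \<in> M_plus"
    and le: "\<And>s. 0 < s \<Longrightarrow> s \<le> 1 \<Longrightarrow>
      (\<integral>\<^sup>+x. indicator {0<..<s} x * rearr01 a x \<partial>I01) \<le> C *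
        (\<integral>\<^sup>+x. indicator {0<..<s} x * rearr01 b x \<partial>I01)"
  shows "associate_norm N a \<le> C * associate_norm N b"
proof (rule associate_norm_least)
  fix f assume f: "f \<in> M_plus" "N f \<le> 1"
  have "(\<integral>\<^sup>+ s. f s * a s \<partial>I01) \<le> (\<integral>\<^sup>+ s. rearr01 f s * rearr01 a s \<partial>I01)"
    by (rule hardy_littlewood[OF f(1) a])
  also have "\<dots> \<le> C * (\<integral>\<^sup>+ s. rearr01 f s * rearr01 b s \<partial>I01)"
    using hardy_lemma[OF rearr_M_plus rearr_M_plus f(1) le] by (simp add: mult.commute)
  also have "\<dots> \<le> C * associate_norm N b"
    by (intro mult_left_mono associate_norm_ge_rearr[OF N f b]) simp
  finally show "(\<integral>\<^sup>+ s. f s * a s \<partial>I01) \<le> C * associate_norm N b" .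
qed

lemma hoelder:
  assumes N: "ri_function_norm N" and f: "f \<in> M_plus" and g: "g \<in> M_plus" and le:
    "associate_norm N g \<le> 1"
  shows "(\<integral>\<^sup>+ s. f s * g s \<partial>I01) \<le> N f"
proof -
  \<comment> \<open>Normalising f by its norm requires that norm to be positive and finite.\<close>
  consider "N f = 0" | r where "0 < r" "N f = ennreal r" | "N f = top"
    by (cases "N f") (auto simp: less_le)
  then show ?thesis
  proof cases
    case 1
    then have "AE s in I01. f s = 0" using ri_zero[OF N f] by simp
    then have "(\<integral>\<^sup>+ s. f s * g s \<partial>I01) = 0"
      using f g by (subst nn_integral_0_iff_AE) (auto elim!: eventually_mono)
    then show ?thesis by simp
  next
    case (2 r)
    have "N (\<lambda>s. ennreal (1 / r) * f s) = ennreal (1 / r) * ennreal r"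
      using ri_scale[OF N f, of "1 / r"] 2 by simp
    also have "\<dots> = 1" using 2 by (simp flip: ennreal_mult)
    finally have "(\<integral>\<^sup>+ s. (ennreal (1 / r) * f s) * g s \<partial>I01) \<le> 1"
      using f le by (intro order_trans[OF associate_norm_upper[of _ N]]) auto
    then have "ennreal (1 / r) * (\<integral>\<^sup>+ s. f s * g s \<partial>I01) \<le> 1"
      using f g by (simp add: mult.assoc nn_integral_cmult)
    then have "ennreal r * (ennreal (1 / r) * (\<integral>\<^sup>+ s. f s * g s \<partial>I01)) \<le> ennreal r * 1"
      by (rule mult_left_mono) simp
    then show ?thesis using 2 by (simp add: mult.assoc[symmetric] flip: ennreal_mult)
  qed simp
qed

section \<open>The Lorentz--Luxemburg theorem\<close>

text \<open>Convexity of the unit ball, in the real-valued form used by the L^2 projection.\<close>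

lemma ri_convex_comb:
  fixes u v :: "real \<Rightarrow> real"
  assumes N: "ri_function_norm N" and [measurable]: "u \<in> borel_measurable I01"
    "v \<in> borel_measurable I01"
    and nonneg: "\<And>s. 0 \<le> u s" "\<And>s. 0 \<le> v s"
    and le: "N (\<lambda>s. ennreal (u s)) \<le> 1" "N (\<lambda>s. ennreal (v s)) \<le> 1" and e: "0 \<le> e" "e \<le> 1"
  shows "N (\<lambda>s. ennreal ((1 - e) * u s + e * v s)) \<le> 1"
proof -
  have u: "(\<lambda>s. ennreal (u s)) \<in> M_plus" and v: "(\<lambda>s. ennreal (v s)) \<in> M_plus" by measurable
  have "(\<lambda>s. ennreal ((1 - e) * u s + e * v s)) = (\<lambda>s. ennreal (1 - e) * ennreal (u s) + ennreal e
    * ennreal (v s))"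
    using nonneg e by (auto simp: ennreal_plus ennreal_mult)
  then have "N (\<lambda>s. ennreal ((1 - e) * u s + e * v s)) \<le> N (\<lambda>s. ennreal (1 - e) * ennreal (u s))
    + N (\<lambda>s. ennreal e * ennreal (v s))"
    using ri_triangle[OF N, of "\<lambda>s. ennreal (1 - e) * ennreal (u s)" "\<lambda>s. ennreal e
      * ennreal (v s)"] by simp
  also have "\<dots> = ennreal (1 - e) * N (\<lambda>s. ennreal (u s)) + ennreal e * N (\<lambda>s. ennreal (v s))"
    using e by (simp only: ri_scale[OF N u] ri_scale[OF N v] diff_ge_0_iff_ge)
  also have "\<dots> \<le> ennreal (1 - e) * 1 + ennreal e * 1"
    by (intro add_mono mult_left_mono le) auto
  also have "\<dots> = 1" using e by (simp flip: ennreal_plus)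
  finally show ?thesis .
qed

text \<open>The tail infima increase to the liminf and each lies below a member of the sequence, so
  the Fatou axiom applies to them.\<close>

lemma ri_liminf:
  fixes F :: "nat \<Rightarrow> real \<Rightarrow> ennreal"
  assumes N: "ri_function_norm N" and F [measurable]: "\<And>j. F j \<in> M_plus" and le: "\<And>j. N (F j) \<le> c"
  shows "N (\<lambda>s. liminf (\<lambda>j. F j s)) \<le> c"
proof -
  define H where "H n s = (INF m\<in>{n..}. F m s)" for n s
  have H [measurable]: "H n \<in> M_plus" for n unfolding H_def by measurable
  have inc: "incseq (\<lambda>n. H n s)" for s
    unfolding H_def by (intro incseq_SucI INF_superset_mono) auto
  have eq: "liminf (\<lambda>j. F j s) = (SUP n. H n s)" for s
    unfolding liminf_SUP_INF H_def ..
  have lim: "(\<lambda>n. N (H n)) \<longlonglongrightarrow> N (\<lambda>s. liminf (\<lambda>j. F j s))"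
  proof (rule ri_fatou(2)[OF N])
    show "(\<lambda>s. liminf (\<lambda>j. F j s)) \<in> M_plus" by measurable
    show "AE s in I01. incseq (\<lambda>n. H n s) \<and> (\<lambda>n. H n s) \<longlonglongrightarrow> liminf (\<lambda>j. F j s)"
      unfolding eq using inc LIMSEQ_SUP by auto
  qed (rule H)
  have "N (H n) \<le> c" for n
  proof -
    have "N (H n) \<le> N (F n)"
      by (rule ri_mono[OF N]) (auto simp: H_def intro: INF_lower)
    also have "\<dots> \<le> c" by (rule le)
    finally show ?thesis .
  qed
  then show ?thesis by (intro LIMSEQ_le_const2[OF lim]) auto
qed

lemma measure_I01_space: "measure I01 {0<..<1} = 1"
  using emeasure_I01_interval[of 0 1] by (simp add: measure_def)

text \<open>Decay of order 4^-n for the squares makes the increments summable in L^1, hence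
  absolutely summable at almost every point, and the sequence is their telescoping sum.\<close>

lemma AE_convergent_of_quadratic_decay:
  fixes G :: "nat \<Rightarrow> real \<Rightarrow> real"
  assumes [measurable]: "\<And>n. G n \<in> borel_measurable I01" and bound: "\<And>n s. \<bar>G n s\<bar> \<le> b"
    and decay: "\<And>n. (\<integral>s. (G (Suc n) s - G n s)\<^sup>2 \<partial>I01) \<le> 4 * (1/4) ^ n"
  shows "AE s in I01. convergent (\<lambda>n. G n s)"
proof -
  interpret finite_measure I01 by (rule finite_I01)
  define d where "d n s = \<bar>G (Suc n) s - G n s\<bar>" for n s
  have [measurable]: "d n \<in> borel_measurable I01" for n unfolding d_def by measurable
  have d_le: "d n s \<le> 2 * b" for n s
    using bound[of n s] bound[of "Suc n" s] unfolding d_def by linarith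
  have d_nn: "0 \<le> d n s" for n s by (simp add: d_def)
  have int: "integrable I01 (d n)" for n
    using d_le d_nn by (intro integrable_const_bound[of _ "2 * b"]) auto
  have int2: "integrable I01 (\<lambda>s. (d n s)\<^sup>2)" for n
    using power_mono[OF d_le d_nn, of _ _ 2] by (intro integrable_const_bound[of _ "(2
      * b)\<^sup>2"]) auto
  have "(\<integral>s. d n s \<partial>I01) \<le> 5 * (1/2) ^ n" for n
  proof -
    \<comment> \<open>Where d exceeds 2^-n, multiply 1 < 2^n d by d. Integration then gives 2^n
      times 4 * 4^-n, plus 2^-n, which is 5 * 2^-n.\<close>
    have "d n s \<le> 2 ^ n * (d n s)\<^sup>2 + (1/2) ^ n" for s
    proof (cases "d n s \<le> (1/2) ^ n")
      case True then show ?thesis by (intro add_increasing) auto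
    next
      case False
      then have "1 \<le> 2 ^ n * d n s" by (simp add: power_one_over field_simps)
      then have "1 * d n s \<le> (2 ^ n * d n s) * d n s" by (intro mult_right_mono d_nn)
      also have "\<dots> \<le> 2 ^ n * (d n s)\<^sup>2 + (1/2) ^ n" by (simp add: power2_eq_square)
      finally show ?thesis by simp
    qed
    then have "(\<integral>s. d n s \<partial>I01) \<le> (\<integral>s. 2 ^ n * (d n s)\<^sup>2 + (1/2) ^ n \<partial>I01)"
      using int int2 by (intro integral_mono) auto
    also have "\<dots> = 2 ^ n * (\<integral>s. (d n s)\<^sup>2 \<partial>I01) + (1/2) ^ n"
      using int2 by (simp add: measure_I01_space)
    also have "\<dots> \<le> 2 ^ n * (4 * (1/4) ^ n) + (1/2) ^ n"
      using decay[of n] by (intro add_right_mono mult_left_mono) (simp_all add: d_def)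
    also have "\<dots> = 5 * (1/2) ^ n"
      by (simp add: power_one_over field_simps flip: power_mult_distrib)
    finally show ?thesis .
  qed
  then have "(\<integral>\<^sup>+s. ennreal (d n s) \<partial>I01) \<le> ennreal (5 * (1/2) ^ n)" for n
    using int d_nn by (subst nn_integral_eq_integral) (auto intro: ennreal_leI)
  then have "(\<Sum>n. \<integral>\<^sup>+s. ennreal (d n s) \<partial>I01) \<le> (\<Sum>n. ennreal (5 * (1/2) ^ n))"
    by (intro suminf_le) auto
  also have "\<dots> < top"
    by (subst less_top[symmetric])
      (intro ennreal_suminf_neq_top summable_mult summable_geometric, auto)
  finally have "(\<integral>\<^sup>+s. (\<Sum>n. ennreal (d n s)) \<partial>I01) \<noteq> \<infinity>"
    by (subst nn_integral_suminf) (auto simp: top_unique less_top)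
  then have "AE s in I01. (\<Sum>n. ennreal (d n s)) \<noteq> \<infinity>"
    by (intro nn_integral_PInf_AE) auto
  then show ?thesis
  proof eventually_elim
    fix s assume "(\<Sum>n. ennreal (d n s)) \<noteq> \<infinity>"
    then have "summable (\<lambda>n. d n s)" by (intro summable_suminf_not_top) (auto simp: d_nn)
    then have "summable (\<lambda>n. G (Suc n) s - G n s)" unfolding d_def by (rule summable_rabs_cancel)
    then have "(\<lambda>n. G 0 s + (\<Sum>i<n. G (Suc i) s - G i s)) \<longlonglongrightarrow> G 0 s + (\<Sum>i. G (Suc i) s - G i s)"
      by (intro tendsto_add tendsto_const summable_LIMSEQ)
    then show "convergent (\<lambda>n. G n s)"
      using sum_lessThan_telescope[of "\<lambda>n. G n s"] by (auto simp: convergent_def)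
  qed
qed

text \<open>Restricting the unit ball to functions below the bounded function \<open>f\<close> keeps everything
  bounded.
  A minimizing sequence is Cauchy in \<open>L\<^sup>2\<close>
    by the parallelogram law; choosing it geometrically fast makes
  it converge almost everywhere, and the Fatou property keeps the limit in the unit ball.\<close>

lemma exists_nearest_function:
  fixes f :: "real \<Rightarrow> real"
  assumes N: "ri_function_norm N" and f [measurable]: "f \<in> borel_measurable I01"
    and f_bound: "\<And>s. 0 \<le> f s" "\<And>s. f s \<le> b"
  obtains g where "g \<in> borel_measurable I01" "\<And>s. 0 \<le> g s" "\<And>s. g s \<le> f s"
    "N (\<lambda>s. ennreal (g s)) \<le> 1"
    "\<And>v. v \<in> borel_measurable I01 \<Longrightarrow> (\<And>s. 0 \<le> v s) \<Longrightarrow> (\<And>s. v s \<le> f s) \<Longrightarrow>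
       N (\<lambda>s. ennreal (v s)) \<le> 1 \<Longrightarrow> (\<integral>s. (f s - g s)\<^sup>2 \<partial>I01) \<le> (\<integral>s. (f s - v s)\<^sup>2 \<partial>I01)"
proof -
  interpret finite_measure I01 by (rule finite_I01)
  define A where "A = {g \<in> borel_measurable I01. (\<forall>s. 0 \<le> g s \<and> g s \<le> f s) \<and> N (\<lambda>s. ennreal (g s))
    \<le> 1}"
  define \<Phi> where "\<Phi> g = (\<integral>s. (f s - g s)\<^sup>2 \<partial>I01)" for g
  define I where "I = Inf (\<Phi> ` A)"
  have b: "0 \<le> b" using f_bound[of 0] by linarith
  have "N (\<lambda>_. 0) = 0" using ri_zero[OF N const_M_plus, of 0] by simp
  then have A_ne: "(\<lambda>_. 0) \<in> A" using f_bound by (auto simp: A_def)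
  have bdd: "bdd_below (\<Phi> ` A)" by (rule bdd_belowI[of _ 0]) (auto simp: \<Phi>_def)
  have I_le: "I \<le> \<Phi> g" if "g \<in> A" for g
    unfolding I_def using bdd that by (intro cInf_lower) auto
  have meas: "g \<in> borel_measurable I01" if "g \<in> A" for g using that by (simp add: A_def)
  have int2: "integrable I01 (\<lambda>s. (u s)\<^sup>2)" if "u \<in> borel_measurable I01" "\<And>s. \<bar>u s\<bar> \<le> b" for u
  proof (rule integrable_const_bound[of _ "b\<^sup>2"])
    have "(u s)\<^sup>2 \<le> b\<^sup>2" for s using power_mono[OF that(2)[of s], of 2] by simp
    then show "AE s in I01. norm ((u s)\<^sup>2) \<le> b\<^sup>2" by simp
  qed (use that in measurable)
  have diff: "\<bar>f s - g s\<bar> \<le> b" if "g \<in> A" for g s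
    using that f_bound[of s] unfolding A_def abs_le_iff by (auto simp: algebra_simps) (smt (verit))+
  have diff2: "\<bar>g s - h s\<bar> \<le> b" if "g \<in> A" "h \<in> A" for g h s
    using that f_bound[of s] unfolding A_def abs_le_iff by (auto simp: algebra_simps) (smt (verit))+
  have "\<exists>g\<in>A. \<Phi> g < I + (1/4) ^ n" for n :: nat
    using cInf_lessD[of "\<Phi> ` A" "I + (1/4) ^ n"] A_ne unfolding I_def by auto
  then obtain G where G: "\<And>n. G n \<in> A" "\<And>n. \<Phi> (G n) < I + (1/4) ^ n" by metis
  have Gm [measurable]: "G n \<in> borel_measurable I01" for n using meas G by blast
  have G_bound: "0 \<le> G n s" "G n s \<le> f s" for n s using G(1)[of n] by (auto simp: A_def)
  have "AE s in I01. convergent (\<lambda>n. G n s)"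
  proof (rule AE_convergent_of_quadratic_decay[of _ b])
    show "\<bar>G n s\<bar> \<le> b" for n s using G_bound[of n s] f_bound[of s] by linarith
    fix n
    \<comment> \<open>The midpoint of consecutive terms is again admissible, so its distance is at
      least I. The parallelogram identity turns this into a bound on their difference, and
      near-minimality leaves 2 (4^-n + 4^-(n+1)), below 4 * 4^-n.\<close>
    define m where "m s = (1 - 1/2) * G n s + (1/2) * G (Suc n) s" for s
    have "m \<in> A"
    proof -
      have "N (\<lambda>s. ennreal (m s)) \<le> 1" unfolding m_def
        using G(1)[of n] G(1)[of "Suc n"] by (intro ri_convex_comb[OF N]) (auto simp: A_def)
      moreover have "0 \<le> m s" "m s \<le> f s" for s
        using G_bound[of n s] G_bound[of "Suc n" s] unfolding m_def by (auto simp: field_simps)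
      moreover have "m \<in> borel_measurable I01" unfolding m_def by measurable
      ultimately show ?thesis by (auto simp: A_def)
    qed
    then have "I \<le> \<Phi> m" by (rule I_le)
    also have "\<Phi> m = (\<integral>s. ((f s - G n s)\<^sup>2 + (f s - G (Suc n) s)\<^sup>2) / 2 - (G (Suc n) s
      - G n s)\<^sup>2 / 4 \<partial>I01)"
      unfolding \<Phi>_def by (intro Bochner_Integration.integral_cong refl)
        (simp add: m_def power2_eq_square field_simps)
    also have "\<dots> = (\<Phi> (G n) + \<Phi> (G (Suc n))) / 2 - (\<integral>s. (G (Suc n) s - G n s)\<^sup>2 \<partial>I01) / 4"
      unfolding \<Phi>_def using int2[of "\<lambda>s. f s - G n s"] int2[of "\<lambda>s. f s - G (Suc n) s"]
        int2[of "\<lambda>s. G (Suc n) s - G n s"] diff[OF G(1)] diff2[OF G(1) G(1)] by simp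
    finally have "(\<integral>s. (G (Suc n) s - G n s)\<^sup>2 \<partial>I01) \<le> 2 * (\<Phi> (G n) + \<Phi> (G (Suc n))) - 4 * I"
      by linarith
    also have "\<dots> \<le> 2 * ((1/4) ^ n + (1/4) ^ Suc n)" using G(2)[of n] G(2)[of "Suc n"] by simp
    also have "\<dots> \<le> 4 * (1/4) ^ n" by simp
    finally show "(\<integral>s. (G (Suc n) s - G n s)\<^sup>2 \<partial>I01) \<le> 4 * (1/4) ^ n" .
  qed (rule Gm)
  \<comment> \<open>The liminf exists at every point, so 0 <= g <= f holds everywhere and not only
    where the sequence converges.\<close>
  define g where "g s = enn2real (liminf (\<lambda>n. ennreal (G n s)))" for s
  have lim_le: "liminf (\<lambda>n. ennreal (G n s)) \<le> ennreal (f s)" for s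
    using G_bound by (intro order_trans[OF Liminf_le_Limsup Limsup_bounded])
      (auto intro!: always_eventually ennreal_leI)
  then have lim_eq: "ennreal (g s) = liminf (\<lambda>n. ennreal (G n s))" for s
    unfolding g_def by (intro ennreal_enn2real le_less_trans[OF lim_le]) simp
  have g [measurable]: "g \<in> borel_measurable I01" unfolding g_def by measurable
  have "N (\<lambda>s. ennreal (g s)) \<le> 1"
    unfolding lim_eq using G(1) by (intro ri_liminf[OF N]) (auto simp: A_def)
  moreover have g0: "0 \<le> g s" for s by (simp add: g_def)
  moreover have g1: "g s \<le> f s" for s
    using lim_le[of s] f_bound(1)[of s] unfolding lim_eq[symmetric] by simp
  ultimately have gA: "g \<in> A" by (simp add: A_def)
  have "(\<lambda>n. \<Phi> (G n)) \<longlonglongrightarrow> \<Phi> g" unfolding \<Phi>_def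
  proof (rule integral_dominated_convergence[where w="\<lambda>_. b\<^sup>2"])
    show "AE s in I01. (\<lambda>n. (f s - G n s)\<^sup>2) \<longlonglongrightarrow> (f s - g s)\<^sup>2"
      using \<open>AE s in I01. convergent (\<lambda>n. G n s)\<close>
    proof eventually_elim
      fix s assume "convergent (\<lambda>n. G n s)"
      then obtain L where L: "(\<lambda>n. G n s) \<longlonglongrightarrow> L" by (auto simp: convergent_def)
      then have "0 \<le> L" using G_bound by (intro LIMSEQ_le_const) auto
      have "(\<lambda>n. ennreal (G n s)) \<longlonglongrightarrow> ennreal L" using L by (rule tendsto_ennrealI)
      then have "liminf (\<lambda>n. ennreal (G n s)) = ennreal L" by (intro lim_imp_Liminf) auto
      then have "g s = L" using \<open>0 \<le> L\<close> by (simp add: g_def)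
      then show "(\<lambda>n. (f s - G n s)\<^sup>2) \<longlonglongrightarrow> (f s - g s)\<^sup>2" using L by (intro tendsto_intros) simp
    qed
    show "AE s in I01. norm ((f s - G n s)\<^sup>2) \<le> b\<^sup>2" for n
    proof (rule AE_I2)
      fix s show "norm ((f s - G n s)\<^sup>2) \<le> b\<^sup>2" using power_mono[OF diff[OF G(1), of s n], of 2]
        by simp
    qed
  qed auto
  moreover have "(\<lambda>n. I + (1/4) ^ n) \<longlonglongrightarrow> I + 0"
    by (intro tendsto_add tendsto_const LIMSEQ_power_zero) simp
  ultimately have "\<Phi> g \<le> I + 0"
    by (rule LIMSEQ_le) (auto intro: less_imp_le[OF G(2)])
  show thesis
  proof
    show "g \<in> borel_measurable I01" "\<And>s. 0 \<le> g s" "\<And>s. g s \<le> f s" "N (\<lambda>s. ennreal (g s)) \<le> 1"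
      using gA by (auto simp: A_def)
    fix v assume "v \<in> borel_measurable I01" "\<And>s. 0 \<le> v s" "\<And>s. v s \<le> f s" "N (\<lambda>s. ennreal (v s))
      \<le> 1"
    then have "v \<in> A" by (auto simp: A_def)
    from I_le[OF this] \<open>\<Phi> g \<le> I + 0\<close> show "(\<integral>s. (f s - g s)\<^sup>2 \<partial>I01) \<le> (\<integral>s. (f s - v s)\<^sup>2 \<partial>I01)"
      by (simp add: \<Phi>_def)
  qed
qed

text \<open>The first-order condition at a minimum: divide by e and let e tend to 0. A single small
  e suffices, chosen with q + 1 in the denominator so that q = 0 is covered.\<close>

lemma quadratic_nonneg_imp_le_0:
  fixes p q :: real
  assumes q: "0 \<le> q" and le: "\<And>e. 0 < e \<Longrightarrow> e \<le> 1 \<Longrightarrow> 2 * e * p \<le> e\<^sup>2 * q"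
  shows "p \<le> 0"
proof (rule ccontr)
  assume "\<not> p \<le> 0"
  define e where "e = min 1 (p / (q + 1))"
  have e: "0 < e" "e \<le> 1"
    using \<open>\<not> p \<le> 0\<close> q by (auto simp: e_def)
  have "e * (q + 1) \<le> p / (q + 1) * (q + 1)" using q by (intro mult_right_mono) (auto simp: e_def)
  then have e3: "e * (q + 1) \<le> p" using q by simp
  have "e * (2 * p) \<le> e * (e * q)" using le[OF e] by (simp add: power2_eq_square)
  then have "2 * p \<le> e * q" using e(1) by simp
  also have "e * q \<le> e * (q + 1)" using e(1) by simp
  finally show False using e3 \<open>\<not> p \<le> 0\<close> by linarith
qed

text \<open>Let g be the point nearest to f in L^2 among the elements of the unit ball below f, h =
  f - g, and \<beta> the integral of h g. Minimality bounds the integral of h w by \<beta> for every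
  w in the ball, so h has associate norm at most \<beta>, whereas the integral of f h is \<beta>
  plus that of h^2. Dividing h by \<beta> separates.\<close>

lemma exists_separating_function:
  fixes f :: "real \<Rightarrow> real"
  assumes N: "ri_function_norm N" and f [measurable]: "f \<in> borel_measurable I01"
    and f_bound: "\<And>s. 0 \<le> f s" "\<And>s. f s \<le> b" and gt: "1 < N (\<lambda>s. ennreal (f s))"
  obtains h where "h \<in> M_plus" "associate_norm N h \<le> 1" "1 < (\<integral>\<^sup>+ s. ennreal (f s) * h s \<partial>I01)"
proof -
  interpret finite_measure I01 by (rule finite_I01)
  obtain g where g [measurable]: "g \<in> borel_measurable I01" and g_bound: "\<And>s. 0 \<le> g s" "\<And>s. g s
    \<le> f s"
    and g_le: "N (\<lambda>s. ennreal (g s)) \<le> 1"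
    and near: "\<And>v. v \<in> borel_measurable I01 \<Longrightarrow> (\<And>s. 0 \<le> v s) \<Longrightarrow> (\<And>s. v s \<le> f s) \<Longrightarrow>
       N (\<lambda>s. ennreal (v s)) \<le> 1 \<Longrightarrow> (\<integral>s. (f s - g s)\<^sup>2 \<partial>I01) \<le> (\<integral>s. (f s - v s)\<^sup>2 \<partial>I01)"
    using exists_nearest_function[OF N f f_bound] by blast
  define h where "h s = f s - g s" for s
  have h [measurable]: "h \<in> borel_measurable I01" unfolding h_def by measurable
  have h_nn: "0 \<le> h s" for s using g_bound by (simp add: h_def)
  have h_le: "h s \<le> b" for s using g_bound(1)[of s] f_bound(2)[of s] by (simp add: h_def)
  have g_le_b: "g s \<le> b" for s using g_bound(2)[of s] f_bound(2)[of s] by linarith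
  have b: "0 \<le> b" using f_bound[of 0] by linarith
  have int: "integrable I01 (\<lambda>s. u s * v s)"
    if "u \<in> borel_measurable I01" "v \<in> borel_measurable I01" "\<And>s. 0 \<le> u s" "\<And>s. 0 \<le> v s" "\<And>s. u s
      \<le> c" "\<And>s. v s \<le> d"
    for u v :: "real \<Rightarrow> real" and c d :: real
  proof (rule integrable_const_bound[of _ "c * d"])
    have "0 \<le> c" using that(3)[of 0] that(5)[of 0] by linarith
    then show "AE s in I01. norm (u s * v s) \<le> c * d"
      using that by (auto simp: abs_mult intro!: mult_mono)
    show "(\<lambda>s. u s * v s) \<in> borel_measurable I01" using that(1,2) by measurable
  qed
  define \<beta> where "\<beta> = (\<integral>s. h s * g s \<partial>I01)"
  have int_hg: "integrable I01 (\<lambda>s. h s * g s)" using int[OF h g h_nn g_bound(1) h_le g_le_b] .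
  have int_hh: "integrable I01 (\<lambda>s. h s * h s)" using int[OF h h h_nn h_nn h_le h_le] .
  have int_gg: "integrable I01 (\<lambda>s. g s * g s)"
    using int[OF g g g_bound(1) g_bound(1) g_le_b g_le_b] .
  have real_le: "(\<integral>s. h s * w s \<partial>I01) \<le> \<beta>"
    if w [measurable]: "w \<in> borel_measurable I01" and w_nn: "\<And>s. 0 \<le> w s" and w_le: "\<And>s. w s
      \<le> c" and Nw: "N (\<lambda>s. ennreal (w s)) \<le> 1"
    for w :: "real \<Rightarrow> real" and c
  proof -
    have int_hw: "integrable I01 (\<lambda>s. h s * w s)" using int[OF h w h_nn w_nn h_le w_le] .
    have int_ww: "integrable I01 (\<lambda>s. w s * w s)" using int[OF w w w_nn w_nn w_le w_le] .
    have int_wg: "integrable I01 (\<lambda>s. w s * g s)" using int[OF w g w_nn g_bound(1) w_le g_le_b] .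
    define p where "p = (\<integral>s. h s * w s \<partial>I01) - \<beta>"
    define q where "q = (\<integral>s. w s * w s - 2 * (w s * g s) + g s * g s \<partial>I01)"
    have "q = (\<integral>s. (w s - g s)\<^sup>2 \<partial>I01)"
      unfolding q_def by (intro Bochner_Integration.integral_cong refl)
        (simp add: power2_eq_square algebra_simps)
    then have "0 \<le> q" by simp
    moreover have "2 * e * p \<le> e\<^sup>2 * q" if e: "0 < e" "e \<le> 1" for e
    proof -
      define v where "v s = (1 - e) * g s + e * w s" for s
      have v [measurable]: "v \<in> borel_measurable I01" unfolding v_def by measurable
      have v_nn: "0 \<le> v s" for s using e g_bound(1) w_nn by (simp add: v_def)
      \<comment> \<open>\<open>near\<close> admits only competitors below f. Truncating v at f keeps
        it in the ball and at no point moves it farther from f.\<close>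
      have "N (\<lambda>s. ennreal (min (v s) (f s))) \<le> N (\<lambda>s. ennreal (v s))"
        by (rule ri_mono[OF N]) (auto intro!: AE_I2 ennreal_leI)
      also have "\<dots> \<le> 1"
        unfolding v_def using e by (intro ri_convex_comb[OF N]) (auto simp: g_bound w_nn g_le Nw)
      finally have "(\<integral>s. (f s - g s)\<^sup>2 \<partial>I01) \<le> (\<integral>s. (f s - min (v s) (f s))\<^sup>2 \<partial>I01)"
        using v_nn f_bound by (intro near) auto
      also have "\<dots> \<le> (\<integral>s. h s * h s - 2 * e * (h s * w s) + 2 * e * (h s * g s)
          + e\<^sup>2 * (w s * w s - 2 * (w s * g s) + g s * g s) \<partial>I01)"
      proof (rule integral_mono)
        fix s
        have "(f s - min (v s) (f s))\<^sup>2 \<le> (f s - v s)\<^sup>2" by (simp add: min_def)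
        also have "\<dots> = h s * h s - 2 * e * (h s * w s) + 2 * e * (h s * g s)
          + e\<^sup>2 * (w s * w s - 2 * (w s * g s) + g s * g s)"
          by (simp add: v_def h_def power2_eq_square algebra_simps)
        finally show "(f s - min (v s) (f s))\<^sup>2 \<le> h s * h s - 2 * e * (h s * w s) + 2 * e * (h s
          * g s)
          + e\<^sup>2 * (w s * w s - 2 * (w s * g s) + g s * g s)" .
      next
        show "integrable I01 (\<lambda>s. (f s - min (v s) (f s))\<^sup>2)"
        proof -
          have "f s - min (v s) (f s) \<le> b" for s using v_nn[of s] f_bound[of s] b
            by (simp add: min_def)
          then show ?thesis unfolding power2_eq_square by (intro int[where c=b and d=b]) auto
        qed
      qed (use int_hh int_hw int_hg int_ww int_wg int_gg in auto)
      also have "\<dots> = (\<integral>s. h s * h s \<partial>I01) - 2 * e * (\<integral>s. h s * w s \<partial>I01) + 2 * e * \<beta> + e\<^sup>2 * q"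
        unfolding \<beta>_def q_def using int_hh int_hw int_hg int_ww int_wg int_gg by simp
      also have "(\<integral>s. (f s - g s)\<^sup>2 \<partial>I01) = (\<integral>s. h s * h s \<partial>I01)"
        by (simp add: h_def power2_eq_square)
      finally show ?thesis by (simp add: p_def algebra_simps)
    qed
    ultimately have "p \<le> 0" by (rule quadratic_nonneg_imp_le_0)
    then show ?thesis by (simp add: p_def)
  qed
  have assoc: "associate_norm N (\<lambda>s. ennreal (h s)) \<le> ennreal \<beta>"
  proof (rule associate_norm_least)
    fix w assume w [measurable]: "w \<in> M_plus" and Nw: "N w \<le> 1"
    \<comment> \<open>\<open>real_le\<close> concerns bounded real functions; a general w is reached
      by truncating at height j and monotone convergence.\<close>
    define u where "u j s = enn2real (min (w s) (of_nat j))" for j s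
    have u_eq: "ennreal (u j s) = min (w s) (of_nat j)" for j s
    proof -
      have "min (w s) (of_nat j) < top" by (simp add: min_less_iff_disj of_nat_less_top)
      then show ?thesis unfolding u_def by (rule ennreal_enn2real)
    qed
    have u [measurable]: "u j \<in> borel_measurable I01" for j unfolding u_def by measurable
    have u_le: "u j s \<le> real j" for j s
    proof -
      have "ennreal (u j s) \<le> ennreal (real j)" unfolding u_eq
        by (simp add: ennreal_of_nat_eq_real_of_nat)
      then show ?thesis by simp
    qed
    have "(\<integral>\<^sup>+ s. w s * ennreal (h s) \<partial>I01) = (\<integral>\<^sup>+ s. (SUP j. ennreal (u j s)
      * ennreal (h s)) \<partial>I01)"
    proof (intro nn_integral_cong)
      fix s
      have "w s \<le> (SUP j. ennreal (u j s))"
      proof (rule ennreal_le_if_real_less)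
        fix t assume t: "0 \<le> t" "ennreal t < w s"
        obtain j where "t \<le> real j" using real_arch_simple by blast
        then have "ennreal t \<le> ennreal (u j s)"
          unfolding u_eq using t
            by (simp add: ennreal_of_nat_eq_real_of_nat ennreal_leI less_imp_le)
        then show "ennreal t \<le> (SUP j. ennreal (u j s))" by (rule SUP_upper2[rotated]) simp
      qed
      moreover have "(SUP j. ennreal (u j s)) \<le> w s" unfolding u_eq by (intro SUP_least) simp
      ultimately have "w s = (SUP j. ennreal (u j s))" by (rule antisym)
      then show "w s * ennreal (h s) = (SUP j. ennreal (u j s) * ennreal (h s))"
        by (simp add: SUP_mult_right_ennreal)
    qed
    also have "\<dots> = (SUP j. \<integral>\<^sup>+ s. ennreal (u j s) * ennreal (h s) \<partial>I01)"
    proof (rule nn_integral_monotone_convergence_SUP)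
      have "(of_nat i :: ennreal) \<le> of_nat j" if "i \<le> j" for i j :: nat using that by simp
      then show "incseq (\<lambda>j s. ennreal (u j s) * ennreal (h s))"
        unfolding u_eq incseq_def le_fun_def by (intro allI impI mult_right_mono min.mono) auto
    qed measurable
    also have "\<dots> \<le> ennreal \<beta>"
    proof (rule SUP_least)
      fix j
      have "N (\<lambda>s. ennreal (u j s)) \<le> N w"
        by (rule ri_mono[OF N]) (auto simp: u_eq)
      then have "(\<integral>s. h s * u j s \<partial>I01) \<le> \<beta>"
        using Nw by (intro real_le[of "u j" "real j"] u_le) (auto simp: u_def[of j])
      moreover have "(\<integral>\<^sup>+ s. ennreal (u j s) * ennreal (h s) \<partial>I01) = ennreal (\<integral>s. h s * u j s \<partial>I01)"
      proof -
        have "0 \<le> u j s" for s by (simp add: u_def)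
        then have "integrable I01 (\<lambda>s. h s * u j s)" using int[OF h u h_nn _ h_le u_le] by blast
        moreover have "(\<integral>\<^sup>+ s. ennreal (u j s) * ennreal (h s) \<partial>I01) = (\<integral>\<^sup>+ s. ennreal (h s
          * u j s) \<partial>I01)"
          using h_nn \<open>\<And>s. 0 \<le> u j s\<close> by (simp add: ennreal_mult mult.commute)
        ultimately show ?thesis using h_nn \<open>\<And>s. 0 \<le> u j s\<close>
          by (subst nn_integral_eq_integral[symmetric]) auto
      qed
      ultimately show "(\<integral>\<^sup>+ s. ennreal (u j s) * ennreal (h s) \<partial>I01) \<le> ennreal \<beta>"
        by (simp add: ennreal_leI)
    qed
    finally show "(\<integral>\<^sup>+ s. w s * ennreal (h s) \<partial>I01) \<le> ennreal \<beta>" .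
  qed
  have h_ne: "\<not> (AE s in I01. h s = 0)"
  proof
    assume "AE s in I01. h s = 0"
    then have "N (\<lambda>s. ennreal (f s)) \<le> N (\<lambda>s. ennreal (g s))"
      by (intro ri_mono[OF N]) (auto elim!: eventually_mono simp: h_def)
    with g_le gt show False by simp
  qed
  have hE: "(\<lambda>s. ennreal (h s)) \<in> M_plus" by measurable
  \<comment> \<open>Normalisation needs a positive \<beta>: otherwise the associate norm of h
    vanishes, so h = 0 almost everywhere, against \<open>h_ne\<close>.\<close>
  have "\<beta> \<noteq> 0"
  proof
    assume "\<beta> = 0"
    then have "associate_norm N (\<lambda>s. ennreal (h s)) = 0" using assoc by simp
    then have "AE s in I01. ennreal (h s) = 0" using ri_zero[OF ri_associate_norm[OF N] hE] by simp
    then have "AE s in I01. h s = 0" using h_nn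
      by (auto elim!: eventually_mono simp: ennreal_eq_0_iff intro: antisym)
    with h_ne show False by simp
  qed
  moreover have "0 \<le> \<beta>" unfolding \<beta>_def using h_nn g_bound by (intro integral_nonneg_AE) auto
  ultimately have \<beta>: "0 < \<beta>" by simp
  have hh: "0 < (\<integral>s. h s * h s \<partial>I01)"
  proof -
    have "(\<integral>s. h s * h s \<partial>I01) \<noteq> 0"
      using h_ne int_hh by (subst integral_nonneg_eq_0_iff_AE) auto
    moreover have "0 \<le> (\<integral>s. h s * h s \<partial>I01)" by (intro integral_nonneg_AE) auto
    ultimately show ?thesis by linarith
  qed
  show thesis
  proof
    show "(\<lambda>s. ennreal (1 / \<beta>) * ennreal (h s)) \<in> M_plus" by measurable
    have "associate_norm N (\<lambda>s. ennreal (1 / \<beta>) * ennreal (h s)) = ennreal (1 / \<beta>)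
      * associate_norm N (\<lambda>s. ennreal (h s))"
      using \<beta> by (intro ri_scale[OF ri_associate_norm[OF N] hE]) simp
    also have "\<dots> \<le> ennreal (1 / \<beta>) * ennreal \<beta>" by (intro mult_left_mono assoc) simp
    also have "\<dots> = 1" using \<beta> by (simp flip: ennreal_mult)
    finally show "associate_norm N (\<lambda>s. ennreal (1 / \<beta>) * ennreal (h s)) \<le> 1" .
    have "(\<integral>\<^sup>+ s. ennreal (f s) * (ennreal (1 / \<beta>) * ennreal (h s)) \<partial>I01) = (\<integral>\<^sup>+ s. ennreal ((h s
      * g s + h s * h s) / \<beta>) \<partial>I01)"
    proof (intro nn_integral_cong)
      fix s
      have "f s * (1 / \<beta> * h s) = (h s * g s + h s * h s) / \<beta>" by (simp add: h_def field_simps)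
      moreover have "ennreal (f s) * (ennreal (1 / \<beta>) * ennreal (h s)) = ennreal (f s * (1 / \<beta>
        * h s))"
      proof -
        have "ennreal (1 / \<beta> * h s) = ennreal (1 / \<beta>) * ennreal (h s)"
          using \<beta> h_nn[of s] by (intro ennreal_mult) auto
        moreover have "ennreal (f s * (1 / \<beta> * h s)) = ennreal (f s) * ennreal (1 / \<beta> * h s)"
          using \<beta> h_nn[of s] f_bound(1)[of s] by (intro ennreal_mult) auto
        ultimately show ?thesis by (simp only:)
      qed
      ultimately show "ennreal (f s) * (ennreal (1 / \<beta>) * ennreal (h s)) = ennreal ((h s * g s + h s
        * h s) / \<beta>)" by (simp only:)
    qed
    also have "\<dots> = ennreal (\<integral>s. (h s * g s + h s * h s) / \<beta> \<partial>I01)"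
      using \<beta> h_nn g_bound int_hg int_hh by (intro nn_integral_eq_integral) auto
    also have "(\<integral>s. (h s * g s + h s * h s) / \<beta> \<partial>I01) = (\<beta> + (\<integral>s. h s * h s \<partial>I01)) / \<beta>"
      using int_hg int_hh by (simp add: \<beta>_def)
    finally show "1 < (\<integral>\<^sup>+ s. ennreal (f s) * (ennreal (1 / \<beta>) * ennreal (h s)) \<partial>I01)"
      using hh \<beta> by (simp add: ennreal_less_iff flip: ennreal_1)
  qed
qed

text \<open>One inequality is \<open>hoelder\<close>. If the other failed, the Fatou property would
  give a bounded truncation of f whose norm still exceeds the second associate norm of f. Dividing
  it by a number c in between puts it outside the unit ball, and
  \<open>exists_separating_function\<close> yields a test function that contradicts the choice of
  c.\<close>

theorem lorentz_luxemburg: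
  assumes N: "ri_function_norm N" and f [measurable]: "f \<in> M_plus"
  shows "associate_norm (associate_norm N) f = N f"
proof (rule antisym)
  show "associate_norm (associate_norm N) f \<le> N f"
  proof (rule associate_norm_least)
    fix h assume "h \<in> M_plus" "associate_norm N h \<le> 1"
    then show "(\<integral>\<^sup>+ s. h s * f s \<partial>I01) \<le> N f" using hoelder[OF N f, of h]
      by (simp add: mult.commute)
  qed
  show "N f \<le> associate_norm (associate_norm N) f"
  proof (rule ccontr)
    assume "\<not> N f \<le> associate_norm (associate_norm N) f"
    then have less: "associate_norm (associate_norm N) f < N f" by simp
    define F where "F j s = min (f s) (of_nat j)" for j s
    have F [measurable]: "F j \<in> M_plus" for j unfolding F_def by measurable
    have "(\<lambda>j. N (F j)) \<longlonglongrightarrow> N f"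
    proof (rule ri_fatou(2)[OF N F f], rule AE_I2)
      fix s
      have "incseq (\<lambda>j. F j s)" unfolding F_def by (intro incseq_SucI min.mono) auto
      moreover have "(SUP j. F j s) = f s"
      proof (rule antisym)
        show "(SUP j. F j s) \<le> f s" unfolding F_def by (intro SUP_least) simp
        show "f s \<le> (SUP j. F j s)"
        proof (rule ennreal_le_if_real_less)
          fix t assume t: "0 \<le> t" "ennreal t < f s"
          obtain j where "t \<le> real j" using real_arch_simple by blast
          then have "ennreal t \<le> F j s"
            unfolding F_def using t
              by (simp add: ennreal_of_nat_eq_real_of_nat ennreal_leI less_imp_le)
          then show "ennreal t \<le> (SUP j. F j s)" by (rule SUP_upper2[rotated]) simp
        qed
      qed
      ultimately show "incseq (\<lambda>j. F j s) \<and> (\<lambda>j. F j s) \<longlonglongrightarrow> f s" using LIMSEQ_SUP[of "\<lambda>j. F j s"]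
        by simp
    qed
    then have "\<forall>\<^sub>F j in sequentially. associate_norm (associate_norm N) f < N (F j)" using less
      by (rule order_tendstoD(1))
    then obtain j where "associate_norm (associate_norm N) f < N (F j)" using eventually_happens
      by force
    then obtain c' where c': "associate_norm (associate_norm N) f < c'" "c' < N (F j)" using dense
      by blast
    then obtain c where c: "c' = ennreal c" "0 \<le> c" by (cases c') auto
    have "0 < c" using c' c by (cases "c = 0") auto
    define \<phi> where "\<phi> s = enn2real (F j s) / c" for s
    have F_eq: "F j s = ennreal c * ennreal (\<phi> s)" for s
    proof -
      have "F j s < top" by (simp add: F_def min_less_iff_disj of_nat_less_top)
      then have "ennreal (enn2real (F j s)) = F j s" by (rule ennreal_enn2real)
      moreover have "ennreal c * ennreal (\<phi> s) = ennreal (enn2real (F j s))"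
        using \<open>0 < c\<close> by (simp add: \<phi>_def flip: ennreal_mult)
      ultimately show ?thesis by simp
    qed
    have \<phi> [measurable]: "\<phi> \<in> borel_measurable I01" unfolding \<phi>_def by measurable
    have \<phi>E: "(\<lambda>s. ennreal (\<phi> s)) \<in> M_plus" by measurable
    have "N (F j) = ennreal c * N (\<lambda>s. ennreal (\<phi> s))"
      using ri_scale[OF N \<phi>E c(2)] by (simp flip: F_eq)
    then have "1 < N (\<lambda>s. ennreal (\<phi> s))"
      using c' \<open>0 < c\<close> unfolding c(1)
        by (metis leI mult.right_neutral mult_left_mono not_less zero_le)
    moreover have "0 \<le> \<phi> s" for s using \<open>0 < c\<close> by (simp add: \<phi>_def)
    moreover have "\<phi> s \<le> real j / c" for s
    proof -
      have "enn2real (F j s) \<le> enn2real (of_nat j)"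
        by (rule enn2real_mono) (simp_all add: F_def of_nat_less_top)
      then show ?thesis using \<open>0 < c\<close>
        by (simp add: \<phi>_def divide_right_mono ennreal_of_nat_eq_real_of_nat)
    qed
    ultimately obtain h where h [measurable]: "h \<in> M_plus" and h_le: "associate_norm N h \<le> 1"
      and h_gt: "1 < (\<integral>\<^sup>+ s. ennreal (\<phi> s) * h s \<partial>I01)"
      using exists_separating_function[OF N \<phi>] by blast
    have "ennreal c * 1 \<le> ennreal c * (\<integral>\<^sup>+ s. ennreal (\<phi> s) * h s \<partial>I01)"
      using h_gt by (intro mult_left_mono) (auto intro: less_imp_le)
    also have "\<dots> = (\<integral>\<^sup>+ s. h s * F j s \<partial>I01)"
      unfolding F_eq by (subst nn_integral_cmult[symmetric]) (auto simp: ac_simps)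
    also have "\<dots> \<le> (\<integral>\<^sup>+ s. h s * f s \<partial>I01)"
      by (intro nn_integral_mono mult_left_mono) (auto simp: F_def)
    also have "\<dots> \<le> associate_norm (associate_norm N) f"
      by (rule associate_norm_upper) (fact h, fact h_le)
    finally show False using c' c by simp
  qed
qed

section \<open>Weighted Hardy operators\<close>

definition rint :: "(real \<Rightarrow> ennreal) \<Rightarrow> real \<Rightarrow> ennreal" where
  "rint f s = (\<integral>\<^sup>+x. indicator {0<..<s} x * rearr01 f x \<partial>I01)"

lemma indicator_M_plus [measurable]: "indicator {a<..<b} \<in> M_plus"
  by (rule borel_imp_M_plus) simp

lemma indicator_co_M_plus [measurable]: "indicator {a..<b} \<in> M_plus"
  by (rule borel_imp_M_plus) simp

lemma nn_integral_indicator_initial: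
  "0 \<le> s \<Longrightarrow> s \<le> 1 \<Longrightarrow> (\<integral>\<^sup>+x. indicator {0<..<s} x \<partial>I01) = ennreal s"
  using emeasure_I01_interval[of 0 s] borel_on_I01[of "{0<..<s}"]
  by (subst nn_integral_indicator) (auto simp: Int_absorb2)

text \<open>Identifies the inner integral in \<open>john_norm\<close> with \<open>rint\<close>,
  which is taken over \<open>I01\<close> so that the preceding inequalities apply to it.\<close>

lemma rint_eq_lebesgue:
  assumes "s \<le> 1"
  shows "(\<integral>\<^sup>+ r\<in>{0<..<s}. rearr01 f r \<partial>lebesgue) = rint f s"
proof -
  have "rint f s = (\<integral>\<^sup>+x. (indicator {0<..<s} x * rearr01 f x) * indicator {0<..<1} x \<partial>lebesgue)"
    unfolding rint_def by (rule nn_integral_restrict_space) simp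
  also have "\<dots> = (\<integral>\<^sup>+ r\<in>{0<..<s}. rearr01 f r \<partial>lebesgue)"
    using assms by (intro nn_integral_cong) (auto simp: indicator_def)
  finally show ?thesis ..
qed

lemma rint_mono: "r \<le> s \<Longrightarrow> rint f r \<le> rint f s"
  unfolding rint_def by (intro nn_integral_mono mult_right_mono) (auto simp: indicator_def)

lemma rint_mono_AE:
  assumes "f \<in> M_plus" "g \<in> M_plus" "AE x in I01. f x \<le> g x"
  shows "rint f s \<le> rint g s"
  unfolding rint_def by (intro nn_integral_mono mult_left_mono rearr01_mono_AE assms) simp

lemma rint_borel [measurable]: "rint f \<in> borel_measurable borel"
proof -
  have [measurable]: "(\<lambda>s. rint f (- s)) \<in> borel_measurable borel"
    by (rule borel_measurable_ennreal_antimono) (simp add: rint_mono)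
  have "(\<lambda>s. (\<lambda>s. rint f (- s)) (- s)) \<in> borel_measurable borel" by measurable
  then show ?thesis by simp
qed

lemma rint_cmult:
  assumes "f \<in> M_plus" "0 \<le> c"
  shows "rint (\<lambda>x. ennreal c * f x) s = ennreal c * rint f s"
  unfolding rint_def rearr01_cmult[OF assms]
  using rearr_M_plus by (subst nn_integral_cmult[symmetric]) (auto simp: ac_simps)

text \<open>Hardy-Littlewood with the indicator of E. The distribution function of the indicator is
  at most s below level 1 and zero from there on, so its rearrangement is at most the indicator of
  (0, s).\<close>

lemma rint_ge_set:
  assumes f: "f \<in> M_plus" and E: "E \<in> sets I01" "emeasure I01 E \<le> ennreal s" and s: "0 \<le> s"
  shows "(\<integral>\<^sup>+x. indicator E x * f x \<partial>I01) \<le> rint f s"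
proof -
  have iE: "(indicator E :: real \<Rightarrow> ennreal) \<in> M_plus" using E by measurable
  have "rearr01 (indicator E) x \<le> indicator {0<..<s} x" if x: "0 < x" for x
  proof (rule ennreal_le_if_real_less)
    fix t :: real assume t: "0 \<le> t" "ennreal t < rearr01 (indicator E) x"
    then have *: "ennreal x < distr01 (indicator E) (ennreal t)" by (simp add: less_rearr01_iff iE)
    have "t < 1"
    proof (rule ccontr)
      assume "\<not> t < 1"
      then have "{x \<in> space I01. ennreal t < indicator E x} = {}"
        by (auto simp: indicator_def ennreal_less_one_iff not_less)
      then have "distr01 (indicator E) (ennreal t) = 0" unfolding distr01_def
        by (simp only: emeasure_empty)
      with * show False by simp
    qed
    have "distr01 (indicator E) (ennreal t) \<le> emeasure I01 E"
      unfolding distr01_def using E by (intro emeasure_mono) (auto simp: indicator_def)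
    with * E(2) have "ennreal x < ennreal s" by (metis less_le_trans)
    then have "x < s" using x by (simp add: ennreal_less_iff)
    then show "ennreal t \<le> indicator {0<..<s} x" using x \<open>t < 1\<close> by simp
  qed
  then have "(\<integral>\<^sup>+x. rearr01 (indicator E) x * rearr01 f x \<partial>I01) \<le> rint f s"
    unfolding rint_def by (intro nn_integral_mono mult_right_mono) auto
  with hardy_littlewood[OF iE f] show ?thesis by (rule order_trans)
qed

text \<open>E is the preimage of (0, s) under the rearranging map. With \<open>rint_ge_set\<close>,
  this makes \<open>rint f s\<close> the maximum of the integrals of f over sets of measure
  s.\<close>

lemma rint_attained:
  assumes f: "f \<in> M_plus" and s: "0 \<le> s" "s \<le> 1"
  obtains E where "E \<in> sets I01" "emeasure I01 E = ennreal s" "rint f s \<le> (\<integral>\<^sup>+x. indicator E x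
    * f x \<partial>I01)"
proof -
  obtain \<tau> :: "real \<Rightarrow> real" where \<tau> [measurable]: "\<tau> \<in> borel_measurable I01"
    and eq: "\<And>w. w \<in> borel_measurable borel \<Longrightarrow> (\<integral>\<^sup>+x. w (\<tau> x) \<partial>I01) = (\<integral>\<^sup>+x. w x \<partial>I01)"
    and le: "\<And>x. rearr01 f (\<tau> x) \<le> f x"
    using exists_rearranging_map[OF f] by blast
  define E where "E = {x \<in> space I01. \<tau> x \<in> {0<..<s}}"
  have E: "E \<in> sets I01" unfolding E_def by measurable
  have ind: "indicator E x = indicator {0<..<s} (\<tau> x)" if "x \<in> space I01" for x
    using that unfolding E_def by (auto simp: indicator_def)
  show thesis
  proof
    show "E \<in> sets I01" by fact
    have "emeasure I01 E = (\<integral>\<^sup>+x. indicator {0<..<s} (\<tau> x) \<partial>I01)"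
      by (subst nn_integral_indicator[OF E, symmetric]) (rule nn_integral_cong, rule ind)
    also have "\<dots> = ennreal s"
      by (subst eq) (auto simp: nn_integral_indicator_initial s)
    finally show "emeasure I01 E = ennreal s" .
    have "rint f s = (\<integral>\<^sup>+x. indicator {0<..<s} (\<tau> x) * rearr01 f (\<tau> x) \<partial>I01)"
      unfolding rint_def by (rule eq[symmetric]) measurable
    also have "\<dots> \<le> (\<integral>\<^sup>+x. indicator E x * f x \<partial>I01)"
      by (rule nn_integral_mono)
        (auto simp del: space_restrict_space simp: ind intro!: mult_left_mono le)
    finally show "rint f s \<le> (\<integral>\<^sup>+x. indicator E x * f x \<partial>I01)" .
  qed
qed

text \<open>A set that is optimal for the sum is admissible for each summand. The triangle
  inequality in \<open>ri_hardy_op\<close> rests on this.\<close>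

lemma rint_add:
  assumes f: "f \<in> M_plus" and g: "g \<in> M_plus" and s: "0 \<le> s" "s \<le> 1"
  shows "rint (\<lambda>x. f x + g x) s \<le> rint f s + rint g s"
proof -
  note [measurable] = f g
  have fg: "(\<lambda>x. f x + g x) \<in> M_plus" by measurable
  obtain E where E [measurable]: "E \<in> sets I01" and m: "emeasure I01 E = ennreal s"
    and le: "rint (\<lambda>x. f x + g x) s \<le> (\<integral>\<^sup>+x. indicator E x * (f x + g x) \<partial>I01)"
    using rint_attained[OF fg s] by blast
  note le
  also have "(\<integral>\<^sup>+x. indicator E x * (f x + g x) \<partial>I01) = (\<integral>\<^sup>+x. indicator E x * f x \<partial>I01)
    + (\<integral>\<^sup>+x. indicator E x * g x \<partial>I01)"
    unfolding distrib_left by (intro nn_integral_add) measurable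
  also have "\<dots> \<le> rint f s + rint g s"
    using m s by (intro add_mono rint_ge_set f g E) auto
  finally show ?thesis .
qed

text \<open>Of a set of measure s optimal for f, the part in (0, s) contributes at most the integral
  of f there, and the rest at most c per unit of mass. This serves functions such as
  \<open>hardy_op b f\<close>, which need not be monotone.\<close>

lemma rint_le_tail:
  assumes f: "f \<in> M_plus" and s: "0 \<le> s" "s \<le> 1" and c: "\<And>x. s \<le> x \<Longrightarrow> x < 1 \<Longrightarrow> f x \<le> c"
  shows "rint f s \<le> (\<integral>\<^sup>+x. indicator {0<..<s} x * f x \<partial>I01) + ennreal s * c"
proof -
  obtain E where E [measurable]: "E \<in> sets I01" and m: "emeasure I01 E = ennreal s"
    and le: "rint f s \<le> (\<integral>\<^sup>+x. indicator E x * f x \<partial>I01)"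
    using rint_attained[OF f s] by blast
  note le
  also have "(\<integral>\<^sup>+x. indicator E x * f x \<partial>I01) \<le> (\<integral>\<^sup>+x. indicator {0<..<s} x * f x + c
    * indicator E x \<partial>I01)"
    using c by (intro nn_integral_mono) (auto simp: indicator_def not_less)
  also have "\<dots> = (\<integral>\<^sup>+x. indicator {0<..<s} x * f x \<partial>I01) + c * ennreal s"
    using f m by (subst nn_integral_add) (auto simp: nn_integral_cmult)
  finally show ?thesis by (simp add: mult.commute)
qed

text \<open>Averages of f* over (0, s) decrease in s: on [r, s) the rearrangement is at most its
  value at r, which is at most its average over (0, r). The form without quotients also makes sense
  for infinite integrals.\<close>

lemma rint_concave:
  assumes r: "0 < r" "r \<le> s" "s \<le> 1"
  shows "ennreal r * rint f s \<le> ennreal s * rint f r"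
proof -
  let ?F = "rearr01 f"
  have rF: "ennreal r * ?F r \<le> rint f r"
  proof -
    have "ennreal r * ?F r = (\<integral>\<^sup>+x. ?F r * indicator {0<..<r} x \<partial>I01)"
      using r by (subst nn_integral_cmult) (auto simp: nn_integral_indicator_initial mult.commute)
    also have "\<dots> \<le> rint f r"
      unfolding rint_def by (intro nn_integral_mono)
        (auto simp: indicator_def intro!: rearr_antimono)
    finally show ?thesis .
  qed
  have "rint f s \<le> (\<integral>\<^sup>+x. indicator {0<..<r} x * ?F x + ?F r * indicator {r..<s} x \<partial>I01)"
    unfolding rint_def by (intro nn_integral_mono) (auto simp: indicator_def intro!: rearr_antimono)
  also have "\<dots> = rint f r + (\<integral>\<^sup>+x. ?F r * indicator {r..<s} x \<partial>I01)"
    unfolding rint_def using rearr_M_plus by (intro nn_integral_add) measurable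
  also have "(\<integral>\<^sup>+x. ?F r * indicator {r..<s} x \<partial>I01) = ?F r * emeasure I01 {r..<s}"
  proof (rule nn_integral_cmult_indicator)
    have "{r..<s} \<inter> {0<..<1} = {r..<s}" using r by auto
    then show "{r..<s} \<in> sets I01" using borel_on_I01[of "{r..<s}"] by simp
  qed
  also have "emeasure I01 {r..<s} = ennreal (s - r)"
    using r by (subst emeasure_restrict_space) auto
  finally have "ennreal r * rint f s \<le> ennreal r * (rint f r + ?F r * ennreal (s - r))"
    by (rule mult_left_mono) simp
  also have "\<dots> = ennreal r * rint f r + ennreal (s - r) * (ennreal r * ?F r)"
    by (simp add: distrib_left ac_simps)
  also have "\<dots> \<le> ennreal r * rint f r + ennreal (s - r) * rint f r"
    by (intro add_left_mono mult_left_mono rF) simp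
  also have "\<dots> = (ennreal r + ennreal (s - r)) * rint f r" by (simp add: distrib_right)
  also have "ennreal r + ennreal (s - r) = ennreal s" using r by (simp flip: ennreal_plus)
  finally show ?thesis .
qed

lemma nn_integral_powr:
  assumes p: "-1 < p" and s: "0 \<le> s" "s \<le> 1"
  shows "(\<integral>\<^sup>+x. indicator {0<..<s} x * ennreal (x powr p) \<partial>I01) = ennreal (s powr (p + 1) / (p
    + 1))"
proof -
  have "(\<integral>\<^sup>+x. indicator {0<..<s} x * ennreal (x powr p) \<partial>I01)
      = (\<integral>\<^sup>+x. (indicator {0<..<s} x * ennreal (x powr p)) * indicator {0<..<1} x \<partial>lebesgue)"
    by (rule nn_integral_restrict_space) simp
  also have "\<dots> = (\<integral>\<^sup>+x. (indicator {0<..<s} x * ennreal (x powr p)) * indicator {0<..<1} x \<partial>lborel)"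
    by (rule nn_integral_completion)
  also have "\<dots> = (\<integral>\<^sup>+x. ennreal (x powr p) * indicator {0..s} x \<partial>lborel)"
  proof (rule nn_integral_cong_AE)
    have "AE x in lborel. x \<noteq> 0 \<and> x \<noteq> s \<and> x \<noteq> (1::real)"
      using AE_lborel_singleton[of 0] AE_lborel_singleton[of s] AE_lborel_singleton[of 1]
        by eventually_elim auto
    then show "AE x in lborel. (indicator {0<..<s} x * ennreal (x powr p)) * indicator {0<..<1} x
      = ennreal (x powr p) * indicator {0..s} x"
      by eventually_elim (use s in \<open>auto simp: indicator_def\<close>)
  qed
  also have "\<dots> = ennreal (s powr (p + 1) / (p + 1))"
    by (rule nn_integral_has_integral_lebesgue') (use has_integral_powr_from_0[OF p s(1)] in auto)
  finally show ?thesis .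
qed

section \<open>The operators T_a and the norms they induce\<close>

definition hardy_op :: "real \<Rightarrow> (real \<Rightarrow> ennreal) \<Rightarrow> real \<Rightarrow> ennreal" where
  "hardy_op a f s = ennreal (s powr (-1 + a)) * rint f s"

lemma hardy_op_borel [measurable]: "hardy_op a f \<in> borel_measurable borel"
  unfolding hardy_op_def[abs_def] by measurable

lemma hardy_op_M_plus [measurable]: "hardy_op a f \<in> M_plus"
  by (rule borel_imp_M_plus) (rule hardy_op_borel)

lemma hardy_op_add:
  assumes "f \<in> M_plus" "g \<in> M_plus" "0 \<le> s" "s \<le> 1"
  shows "hardy_op a (\<lambda>x. f x + g x) s \<le> hardy_op a f s + hardy_op a g s"
  unfolding hardy_op_def distrib_left[symmetric] by (intro mult_left_mono rint_add assms) simp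

text \<open>Concavity between s and 1 bounds the integral of f* over (0, s) below by s times the
  full integral. The resulting minorant s^a provides the L^1 bound of the induced norm.\<close>

lemma hardy_op_ge_integral:
  assumes f: "f \<in> M_plus" and s: "0 < s" "s < 1"
  shows "ennreal (s powr a) * (\<integral>\<^sup>+x. f x \<partial>I01) \<le> hardy_op a f s"
proof -
  have "(\<integral>\<^sup>+x. f x \<partial>I01) = (\<integral>\<^sup>+x. indicator {0<..<1} x * f x \<partial>I01)"
    by (intro nn_integral_cong) auto
  also have "\<dots> \<le> rint f 1"
    using emeasure_I01_interval[of 0 1] borel_on_I01[of "{0<..<1}"] by (intro rint_ge_set f) auto
  finally have "ennreal s * (\<integral>\<^sup>+x. f x \<partial>I01) \<le> ennreal s * rint f 1" by (rule mult_left_mono) simp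
  also have "\<dots> \<le> rint f s" using rint_concave[of s 1 f] s by simp
  finally have "ennreal (s powr (-1 + a)) * (ennreal s * (\<integral>\<^sup>+x. f x \<partial>I01)) \<le> hardy_op a f s"
    unfolding hardy_op_def by (rule mult_left_mono) simp
  moreover have "s powr a = s powr (-1 + a) * s"
    using s powr_add[of s "-1 + a" 1] by simp
  ultimately show ?thesis using s by (simp add: ennreal_mult mult.assoc)
qed

lemma hardy_op_SUP:
  assumes F: "\<And>j. F j \<in> M_plus" and f: "f \<in> M_plus"
    and lim: "AE s in I01. incseq (\<lambda>j. F j s) \<and> (\<lambda>j. F j s) \<longlonglongrightarrow> f s"
  shows "incseq (\<lambda>j::nat. hardy_op a (F j) s)" "(\<lambda>j. hardy_op a (F j) s) \<longlonglongrightarrow> hardy_op a f s"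
proof -
  have inc: "rearr01 (F i) x \<le> rearr01 (F j) x" if "i \<le> j" for i j x
    using rearr01_SUP(1)[OF F f lim] that by (auto simp: incseq_def)
  show *: "incseq (\<lambda>j. hardy_op a (F j) s)"
    unfolding incseq_def hardy_op_def rint_def by (auto intro!: mult_left_mono nn_integral_mono inc)
  have "rint f s = (\<integral>\<^sup>+x. (SUP j. indicator {0<..<s} x * rearr01 (F j) x) \<partial>I01)"
    unfolding rint_def rearr01_SUP(2)[OF F f lim] SUP_mult_left_ennreal ..
  also have "\<dots> = (SUP j. rint (F j) s)"
    unfolding rint_def
  proof (rule nn_integral_monotone_convergence_SUP)
    show "incseq (\<lambda>j x. indicator {0<..<s} x * rearr01 (F j) x)"
      unfolding incseq_def le_fun_def by (auto intro!: mult_left_mono inc)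
    show "(\<lambda>x. indicator {0<..<s} x * rearr01 (F j) x) \<in> M_plus" for j
      using rearr_M_plus by measurable
  qed
  finally have "hardy_op a f s = (SUP j. hardy_op a (F j) s)"
    unfolding hardy_op_def by (simp add: SUP_mult_left_ennreal)
  then show "(\<lambda>j. hardy_op a (F j) s) \<longlonglongrightarrow> hardy_op a f s" using LIMSEQ_SUP[OF *] by simp
qed

text \<open>By \<open>hardy_op_ge_integral\<close> the constant is the reciprocal of the norm of
  s^a, which is positive and finite because 0 < s^a <= 1 on the unit interval.\<close>

lemma integral_le_norm_hardy_op:
  assumes N: "ri_function_norm N" and a: "0 < a"
  obtains C :: real where "0 < C" "\<And>f. f \<in> M_plus \<Longrightarrow> (\<integral>\<^sup>+x. f x \<partial>I01) \<le> ennreal C * N (hardy_op a f)"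
proof -
  define w where "w s = ennreal (s powr a)" for s
  have w: "w \<in> M_plus" unfolding w_def by (rule borel_imp_M_plus) measurable
  have "N w \<noteq> 0"
  proof
    assume "N w = 0"
    then have "AE s in I01. w s = 0" using ri_zero[OF N w] by simp
    moreover have "AE s in I01. s \<in> {0<..<1}" by (rule AE_I2) simp
    ultimately have "AE s in I01. (1::ennreal) = 0" by eventually_elim (auto simp: w_def)
    then have "N (\<lambda>_. 1) = 0" by (simp only: ri_zero[OF N const_M_plus])
    then show False using ri_one_pos[OF N] by simp
  qed
  moreover have "N w < top"
  proof -
    have "N w \<le> N (\<lambda>_. 1)"
      using a by (intro ri_mono[OF N w const_M_plus] AE_I2) (auto simp: w_def powr_le1)
    then show ?thesis using ri_one[OF N] by simp
  qed
  ultimately obtain k where k: "0 < k" "N w = ennreal k" by (cases "N w") auto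
  have "(\<integral>\<^sup>+x. f x \<partial>I01) \<le> ennreal (1 / k) * N (hardy_op a f)" if f: "f \<in> M_plus" for f
  \<comment> \<open>The integral of f may be infinite, whereas \<open>ri_scale\<close> takes real
    factors; hence all real c below it are tested.\<close>
  proof (rule ennreal_le_if_real_less)
    fix c :: real assume c: "0 \<le> c" "ennreal c < (\<integral>\<^sup>+x. f x \<partial>I01)"
    have "ennreal c * ennreal k = N (\<lambda>s. ennreal c * w s)" using ri_scale[OF N w c(1)] k by simp
    also have "\<dots> \<le> N (hardy_op a f)"
    proof (rule ri_mono[OF N])
      show "AE s in I01. ennreal c * w s \<le> hardy_op a f s"
      proof (rule AE_I2)
        fix s assume "s \<in> space I01"
        then have s: "0 < s" "s < 1" by auto
        have "ennreal c * w s \<le> w s * (\<integral>\<^sup>+x. f x \<partial>I01)"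
          using c(2) by (subst mult.commute) (intro mult_left_mono, auto)
        also have "\<dots> \<le> hardy_op a f s" unfolding w_def by (rule hardy_op_ge_integral[OF f s])
        finally show "ennreal c * w s \<le> hardy_op a f s" .
      qed
      show "(\<lambda>s. ennreal c * w s) \<in> M_plus" using w by measurable
    qed (rule hardy_op_M_plus)
    finally have "ennreal (1 / k) * (ennreal c * ennreal k) \<le> ennreal (1 / k) * N (hardy_op a f)"
      by (rule mult_left_mono) simp
    then show "ennreal c \<le> ennreal (1 / k) * N (hardy_op a f)" using k c
      by (simp flip: ennreal_mult)
  qed
  then show thesis using k by (intro that[of "1 / k"]) auto
qed

text \<open>Prepares the witness for the choice in \<open>john_norm\<close>. Subadditivity comes
  from \<open>rint_add\<close>, and finiteness at 1 from the bound s^a <= 1 on the image of the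
  constant 1.\<close>

lemma ri_hardy_op:
  assumes N: "ri_function_norm N" and a: "0 < a"
  shows "ri_function_norm (\<lambda>f. N (hardy_op a f))"
proof -
  obtain C :: real where C: "0 < C" "\<And>f. f \<in> M_plus \<Longrightarrow> (\<integral>\<^sup>+x. f x \<partial>I01) \<le> ennreal C
    * N (hardy_op a f)"
    using integral_le_norm_hardy_op[OF N a] by blast
  show ?thesis
    unfolding ri_function_norm_def
  proof (intro conjI ballI allI impI)
    fix f assume f: "f \<in> M_plus"
    show "N (hardy_op a f) = 0 \<longleftrightarrow> (AE s in I01. f s = 0)"
    proof
      assume "N (hardy_op a f) = 0"
      then have "(\<integral>\<^sup>+ s. f s \<partial>I01) = 0" using C(2)[OF f] by simp
      then show "AE s in I01. f s = 0" using f by (simp add: nn_integral_0_iff_AE)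
    next
      assume *: "AE s in I01. f s = 0"
      have "rearr01 f s = 0" for s
        using rearr01_cong_AE[OF f const_M_plus *] by (simp add: rearr01_0)
      then have "hardy_op a f = (\<lambda>_. 0)" by (auto simp: hardy_op_def rint_def)
      then show "N (hardy_op a f) = 0" using ri_zero[OF N const_M_plus, of 0] by simp
    qed
  next
    fix f and c :: real assume f: "f \<in> M_plus" and c: "0 \<le> c"
    have "hardy_op a (\<lambda>s. ennreal c * f s) = (\<lambda>s. ennreal c * hardy_op a f s)"
      using rint_cmult[OF f c] by (auto simp: hardy_op_def ac_simps)
    then show "N (hardy_op a (\<lambda>s. ennreal c * f s)) = ennreal c * N (hardy_op a f)"
      using ri_scale[OF N hardy_op_M_plus c] by simp
  next
    fix f g assume f: "f \<in> M_plus" and g: "g \<in> M_plus"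
    have "N (hardy_op a (\<lambda>s. f s + g s)) \<le> N (\<lambda>s. hardy_op a f s + hardy_op a g s)"
    proof (rule ri_mono[OF N hardy_op_M_plus])
      show "AE s in I01. hardy_op a (\<lambda>s. f s + g s) s \<le> hardy_op a f s + hardy_op a g s"
        by (intro AE_I2 hardy_op_add f g) auto
    qed measurable
    also have "\<dots> \<le> N (hardy_op a f) + N (hardy_op a g)"
      by (rule ri_triangle[OF N hardy_op_M_plus hardy_op_M_plus])
    finally show "N (hardy_op a (\<lambda>s. f s + g s)) \<le> N (hardy_op a f) + N (hardy_op a g)" .
  next
    fix f g assume fg: "f \<in> M_plus" "g \<in> M_plus" "AE s in I01. f s \<le> g s"
    show "N (hardy_op a f) \<le> N (hardy_op a g)"
      by (intro ri_mono[OF N] hardy_op_M_plus AE_I2)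
        (auto simp: hardy_op_def intro!: mult_left_mono rint_mono_AE fg)
  next
    fix F :: "nat \<Rightarrow> real \<Rightarrow> ennreal" and f
    assume F: "\<forall>j. F j \<in> M_plus" and f: "f \<in> M_plus" and
      lim: "AE s in I01. incseq (\<lambda>j. F j s) \<and> (\<lambda>j. F j s) \<longlonglongrightarrow> f s"
    have *: "AE s in I01. incseq (\<lambda>j. hardy_op a (F j) s)
      \<and> (\<lambda>j. hardy_op a (F j) s) \<longlonglongrightarrow> hardy_op a f s"
      using hardy_op_SUP[of F f, OF F[rule_format] f lim] by (intro AE_I2) auto
    show "incseq (\<lambda>j. N (hardy_op a (F j)))" "(\<lambda>j. N (hardy_op a (F j))) \<longlonglongrightarrow> N (hardy_op a f)"
      using ri_fatou[OF N hardy_op_M_plus hardy_op_M_plus *] by auto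
  next
    have "N (hardy_op a (\<lambda>_. 1)) \<le> N (\<lambda>_. 1)"
    proof (intro ri_mono[OF N hardy_op_M_plus const_M_plus] AE_I2)
      fix s assume "s \<in> space I01"
      then have s: "0 < s" "s < 1" by auto
      have "rint (\<lambda>_. 1) s \<le> ennreal s"
        unfolding rint_def using s
        by (subst nn_integral_indicator_initial[of s, symmetric])
          (auto intro!: nn_integral_mono simp: rearr01_const indicator_def)
      then have "hardy_op a (\<lambda>_. 1) s \<le> ennreal (s powr (-1 + a)) * ennreal s"
        unfolding hardy_op_def by (rule mult_left_mono) simp
      also have "\<dots> = ennreal (s powr a)"
        using s powr_add[of s "-1 + a" 1] by (simp flip: ennreal_mult)
      also have "\<dots> \<le> 1" using s a by (simp add: powr_le1)
      finally show "hardy_op a (\<lambda>_. 1) s \<le> 1" .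
    qed
    then show "N (hardy_op a (\<lambda>_. 1)) < \<infinity>" using ri_one[OF N] by (simp add: le_less_trans)
  next
    show "\<exists>C. \<forall>f\<in>M_plus. (\<integral>\<^sup>+ s. f s \<partial>I01) \<le> ennreal C * N (hardy_op a f)" using C(2) by blast
  next
    fix f g assume eq: "\<forall>s\<in>{0<..<1}. rearr01 f s = rearr01 g s"
    have "rint f s = rint g s" for s
      unfolding rint_def using eq by (intro nn_integral_cong) auto
    then show "N (hardy_op a f) = N (hardy_op a g)" by (simp add: hardy_op_def[abs_def])
  qed
qed

text \<open>With Z(f) = X'(T_a f), the associate of Z is a witness for the choice operator: it is an
  r.i. norm, and its own associate is Z again by \<open>lorentz_luxemburg\<close>.\<close>

lemma john_norm_properties:
  assumes X: "ri_function_norm X" and nm: "1 \<le> n" "1 \<le> m"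
  shows "ri_function_norm (john_norm n m X)"
    "\<And>f. f \<in> M_plus \<Longrightarrow> associate_norm (john_norm n m X) f
      = associate_norm X (hardy_op (real m / real n) f)"
proof -
  let ?a = "real m / real n"
  let ?T = "\<lambda>f s. ennreal (s powr (-1 + real m / real n)) * (\<integral>\<^sup>+ r\<in>{0<..<s}. rearr01 f r \<partial>lebesgue)"
  have T_eq: "associate_norm X (?T f) = associate_norm X (hardy_op ?a f)" for f
    by (intro antisym associate_norm_mono AE_I2) (auto simp: hardy_op_def rint_eq_lebesgue)
  have a: "0 < ?a" using nm by simp
  define Z where "Z f = associate_norm X (hardy_op ?a f)" for f
  have Z: "ri_function_norm Z"
    unfolding Z_def by (rule ri_hardy_op[OF ri_associate_norm[OF X] a])
  define P where "P Y \<longleftrightarrow> ri_function_norm Y \<and> (\<forall>f\<in>M_plus. associate_norm Y f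
    = associate_norm X (?T f))" for Y
  have "associate_norm (associate_norm Z) f = associate_norm X (?T f)" if "f \<in> M_plus" for f
    by (simp only: T_eq lorentz_luxemburg[OF Z that]) (simp only: Z_def)
  then have "P (associate_norm Z)"
    using ri_associate_norm[OF Z] by (simp only: P_def) blast
  then have "P (SOME Y. P Y)" by (rule someI[of P])
  moreover have "john_norm n m X = (SOME Y. P Y)" by (simp only: john_norm_def P_def)
  ultimately have *: "P (john_norm n m X)" by simp
  then show "ri_function_norm (john_norm n m X)" by (simp only: P_def)
  show "associate_norm (john_norm n m X) f = associate_norm X (hardy_op ?a f)" if "f \<in> M_plus" for f
  proof -
    have "associate_norm (john_norm n m X) f = associate_norm X (?T f)"
      using * that unfolding P_def by blast
    then show ?thesis by (simp only: T_eq)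
  qed
qed

section \<open>Comparison of the composition of two operators with the operator of the summed
  exponent\<close>

lemma rint_hardy_op_ge:
  assumes f: "f \<in> M_plus" and b: "0 < b" and s: "0 < s" "s \<le> 1"
  shows "ennreal (s powr b) * rint f s \<le> ennreal (1 + b) * rint (hardy_op b f) s"
proof -
  have E: "{0<..<s} \<in> sets I01" "emeasure I01 {0<..<s} = ennreal s"
    using s emeasure_I01_interval[of 0 s] borel_on_I01[of "{0<..<s}"] by (auto simp: Int_absorb2)
  \<comment> \<open>Concavity, x \<open>rint f s\<close> <= s \<open>rint f x\<close>, is integrated
    against x^(b-1) over (0, s); the integral s^(b+1) / (b+1) of x^b produces the factor 1 +
    b.\<close>
  have "ennreal (s powr (b + 1) / (b + 1)) * rint f s = (\<integral>\<^sup>+x. (indicator {0<..<s} x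
    * ennreal (x powr b)) * rint f s \<partial>I01)"
  proof (subst nn_integral_multc)
    show "(\<lambda>x. indicator {0<..<s} x * ennreal (x powr b)) \<in> M_plus"
      by (rule borel_imp_M_plus) measurable
  qed (use nn_integral_powr[of b s] s b in simp)
  also have "\<dots> \<le> (\<integral>\<^sup>+x. ennreal s * (indicator {0<..<s} x * hardy_op b f x) \<partial>I01)"
  proof (rule nn_integral_mono)
    fix x
    show "(indicator {0<..<s} x * ennreal (x powr b)) * rint f s \<le> ennreal s * (indicator {0<..<s} x
      * hardy_op b f x)"
    proof (cases "0 < x \<and> x < s")
      case True
      have "ennreal (x powr (-1 + b)) * (ennreal x * rint f s) \<le> ennreal (x powr (-1 + b))
        * (ennreal s * rint f x)"
        using True s by (intro mult_left_mono rint_concave) auto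
      moreover have "ennreal (x powr (-1 + b)) * ennreal x = ennreal (x powr b)"
        using True powr_add[of x "-1 + b" 1] by (simp flip: ennreal_mult)
      ultimately show ?thesis using True
        by (simp add: hardy_op_def mult.assoc[symmetric]) (simp add: ac_simps)
    qed (auto simp: indicator_def)
  qed
  also have "\<dots> = ennreal s * (\<integral>\<^sup>+x. indicator {0<..<s} x * hardy_op b f x \<partial>I01)"
    using hardy_op_M_plus by (intro nn_integral_cmult) measurable
  \<comment> \<open>\<open>hardy_op b f\<close> need not be decreasing, so its integral over (0, s)
    is bounded by that of its rearrangement.\<close>
  also have "\<dots> \<le> ennreal s * rint (hardy_op b f) s"
    using E s by (intro mult_left_mono rint_ge_set hardy_op_M_plus) auto
  finally have "ennreal ((1 + b) / s) * (ennreal (s powr (b + 1) / (b + 1)) * rint f s)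
    \<le> ennreal ((1 + b) / s) * (ennreal s * rint (hardy_op b f) s)"
    by (rule mult_left_mono) simp
  moreover have "ennreal ((1 + b) / s) * ennreal (s powr (b + 1) / (b + 1)) = ennreal (s powr b)"
  proof -
    have "s powr (b + 1) = s powr b * s" using s powr_add[of s b 1] by simp
    then have "(1 + b) / s * (s powr (b + 1) / (b + 1)) = s powr b"
      using s b by (simp add: add.commute)
    then show ?thesis using s b by (simp flip: ennreal_mult)
  qed
  moreover have "ennreal ((1 + b) / s) * ennreal s = ennreal (1 + b)"
    using s b by (simp flip: ennreal_mult)
  ultimately show ?thesis by (simp only: mult.assoc[symmetric])
qed

lemma hardy_op_add_le_compose:
  assumes f: "f \<in> M_plus" and b: "0 < b" and s: "0 < s" "s < 1"
  shows "hardy_op (a + b) f s \<le> ennreal (1 + b) * hardy_op a (hardy_op b f) s"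
proof -
  have "ennreal (s powr (-1 + a)) * (ennreal (s powr b) * rint f s)
      \<le> ennreal (s powr (-1 + a)) * (ennreal (1 + b) * rint (hardy_op b f) s)"
    using s by (intro mult_left_mono rint_hardy_op_ge f b) auto
  moreover have "ennreal (s powr (-1 + (a + b))) = ennreal (s powr (-1 + a)) * ennreal (s powr b)"
    by (simp add: powr_add[symmetric] algebra_simps flip: ennreal_mult)
  ultimately show ?thesis by (simp add: hardy_op_def ac_simps)
qed

text \<open>The least decreasing majorant of f on the unit interval, the G of the overview.\<close>

definition tail_sup :: "(real \<Rightarrow> ennreal) \<Rightarrow> real \<Rightarrow> ennreal" where
  "tail_sup f s = (SUP t\<in>{s..<1}. f t)"

lemma tail_sup_antimono: "r \<le> s \<Longrightarrow> tail_sup f s \<le> tail_sup f r"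
  unfolding tail_sup_def by (intro SUP_subset_mono) auto

lemma tail_sup_M_plus [measurable]: "tail_sup f \<in> M_plus"
  by (intro borel_imp_M_plus borel_measurable_ennreal_antimono tail_sup_antimono)

lemma tail_sup_upper: "s \<le> t \<Longrightarrow> t < 1 \<Longrightarrow> f t \<le> tail_sup f s"
  unfolding tail_sup_def by (intro SUP_upper) auto

text \<open>\<open>rint f\<close> is increasing and can be replaced by its value at s; what remains
  is the integral of x^(b-1).\<close>

lemma nn_integral_hardy_op_le:
  assumes b: "0 < b" and s: "0 \<le> s" "s \<le> 1"
  shows "(\<integral>\<^sup>+x. indicator {0<..<s} x * hardy_op b f x \<partial>I01) \<le> ennreal (s powr b / b) * rint f s"
proof -
  have "(\<integral>\<^sup>+x. indicator {0<..<s} x * hardy_op b f x \<partial>I01)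
      \<le> (\<integral>\<^sup>+x. (indicator {0<..<s} x * ennreal (x powr (-1 + b))) * rint f s \<partial>I01)"
    unfolding hardy_op_def mult.assoc[symmetric]
    by (intro nn_integral_mono) (auto simp: indicator_def intro!: mult_left_mono rint_mono)
  also have "\<dots> = ennreal (s powr b / b) * rint f s"
  proof (subst nn_integral_multc)
    show "(\<lambda>x. indicator {0<..<s} x * ennreal (x powr (-1 + b))) \<in> M_plus"
      by (rule borel_imp_M_plus) measurable
  qed (use nn_integral_powr[of "-1 + b" s] s b in simp)
  finally show ?thesis .
qed

text \<open>\<open>rint_le_tail\<close> splits T_b f at s. The part in (0, s) costs s^b / b, whence
  the factor 1 / b. In the tail, s^a <= t^a for t >= s moves the weight under the supremum, where
  the exponents add up.\<close>

lemma hardy_op_compose_le: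
  assumes f: "f \<in> M_plus" and a: "0 < a" and b: "0 < b" and s: "0 < s" "s < 1"
  shows "hardy_op a (hardy_op b f) s \<le> tail_sup (hardy_op (a + b) f) s + ennreal (1 / b)
    * hardy_op (a + b) f s"
proof -
  let ?p = "ennreal (s powr (-1 + a))"
  have "rint (hardy_op b f) s \<le> (\<integral>\<^sup>+x. indicator {0<..<s} x * hardy_op b f x \<partial>I01) + ennreal s
    * tail_sup (hardy_op b f) s"
    using s by (intro rint_le_tail hardy_op_M_plus tail_sup_upper) auto
  also have "\<dots> \<le> ennreal (s powr b / b) * rint f s + ennreal s * tail_sup (hardy_op b f) s"
    using s by (intro add_right_mono nn_integral_hardy_op_le b) auto
  finally have "hardy_op a (hardy_op b f) s \<le> ?p * (ennreal (s powr b / b) * rint f s + ennreal s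
    * tail_sup (hardy_op b f) s)"
    unfolding hardy_op_def[of a "hardy_op b f"] by (rule mult_left_mono) simp
  also have "\<dots> = ?p * (ennreal (s powr b / b) * rint f s) + ?p * (ennreal s
    * tail_sup (hardy_op b f) s)"
    by (rule distrib_left)
  also have "?p * (ennreal (s powr b / b) * rint f s) = ennreal (1 / b) * hardy_op (a + b) f s"
  proof -
    have "?p * ennreal (s powr b / b) = ennreal (1 / b) * ennreal (s powr (-1 + (a + b)))"
      using b by (simp add: powr_add[symmetric] algebra_simps flip: ennreal_mult)
    then show ?thesis unfolding hardy_op_def by (simp only: mult.assoc[symmetric])
  qed
  also have "?p * (ennreal s * tail_sup (hardy_op b f) s) \<le> tail_sup (hardy_op (a + b) f) s"
  proof -
    have p: "?p * ennreal s = ennreal (s powr a)"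
      using s powr_add[of s "-1 + a" 1] by (simp flip: ennreal_mult)
    have "ennreal (s powr a) * hardy_op b f t \<le> tail_sup (hardy_op (a + b) f) s" if t:
      "t \<in> {s..<1}" for t
    proof -
      have "ennreal (s powr a) * hardy_op b f t \<le> ennreal (t powr a) * hardy_op b f t"
        using t s a by (intro mult_right_mono ennreal_leI powr_mono2) auto
      also have "\<dots> = hardy_op (a + b) f t"
      proof -
        have "ennreal (t powr a) * ennreal (t powr (-1 + b)) = ennreal (t powr (-1 + (a + b)))"
          by (simp add: powr_add[symmetric] algebra_simps flip: ennreal_mult)
        then show ?thesis unfolding hardy_op_def by (simp only: mult.assoc[symmetric])
      qed
      also have "\<dots> \<le> tail_sup (hardy_op (a + b) f) s" using t by (intro tail_sup_upper) auto
      finally show ?thesis .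
    qed
    then have "(SUP t\<in>{s..<1}. ennreal (s powr a) * hardy_op b f t) \<le> tail_sup (hardy_op (a
      + b) f) s"
      by (rule SUP_least)
    then show ?thesis
      unfolding tail_sup_def[of "hardy_op b f"] mult.assoc[symmetric] p
        by (simp only: SUP_mult_left_ennreal)
  qed
  finally show ?thesis by (simp add: add.commute)
qed

text \<open>The value at t >= s is shared, up to the factor 2^c, by all points u of an interval of
  length s/2 left of t: concavity compares \<open>rint f\<close> at t and u, and u > t/2 compares
  the powers. The length s/2 accounts for the remaining factor 2.\<close>

lemma tail_sup_hardy_op_le_rint:
  assumes f: "f \<in> M_plus" and c: "0 < c" and s: "0 < s" "s \<le> 1"
  shows "ennreal s * tail_sup (hardy_op c f) s \<le> ennreal (2 powr (c + 1)) * rint (hardy_op c f) s"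
proof -
  let ?\<phi> = "hardy_op c f"
  have "ennreal s * ?\<phi> t \<le> ennreal (2 powr (c + 1)) * rint ?\<phi> s" if t: "t \<in> {s..<1}" for t
  proof -
    \<comment> \<open>As s <= t, this interval lies in (t/2, t) and thus in the unit
      interval.\<close>
    define E where "E = {t - s/2<..<t}"
    have t0: "0 < t" "t < 1" "s \<le> t" using t s by auto
    have "E \<subseteq> {0<..<1}" unfolding E_def using t0 s by auto
    then have "E \<inter> {0<..<1} = E" by blast
    moreover have "E \<in> sets borel" by (simp add: E_def)
    ultimately have E [measurable]: "E \<in> sets I01" using borel_on_I01[of E] by (simp only:)
    have mE: "emeasure I01 E = ennreal (s / 2)"
      unfolding E_def using t0 s by (subst emeasure_I01_interval) auto
    have "?\<phi> t \<le> ennreal (2 powr c) * ?\<phi> u" if u: "u \<in> E" for u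
    proof -
      have u0: "t / 2 < u" "u < t" "0 < u" using u t0 s by (auto simp: E_def)
      have "ennreal u * rint f t \<le> ennreal t * rint f u" using u0 t0 by (intro rint_concave) auto
      then have "ennreal (t powr (-1 + c) / u) * (ennreal u * rint f t) \<le> ennreal (t powr (-1
        + c) / u) * (ennreal t * rint f u)"
        by (rule mult_left_mono) simp
      moreover have "ennreal (t powr (-1 + c) / u) * ennreal u = ennreal (t powr (-1 + c))"
        using u0 by (simp flip: ennreal_mult)
      moreover have "ennreal (t powr (-1 + c) / u) * ennreal t = ennreal (t powr c / u)"
        using u0 t0 powr_add[of t "-1 + c" 1] by (simp flip: ennreal_mult)
      ultimately have "?\<phi> t \<le> ennreal (t powr c / u) * rint f u"
        unfolding hardy_op_def by (simp only: mult.assoc[symmetric])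
      also have "\<dots> \<le> ennreal (2 powr c * u powr (-1 + c)) * rint f u"
      proof (intro mult_right_mono ennreal_leI)
        have "t powr c \<le> (2 * u) powr c" using u0 t0 c by (intro powr_mono2) auto
        also have "\<dots> = 2 powr c * u powr c" using u0 by (simp add: powr_mult)
        also have "u powr c = u powr (-1 + c) * u" using u0 powr_add[of u "-1 + c" 1] by simp
        finally show "t powr c / u \<le> 2 powr c * u powr (-1 + c)" using u0 by (simp add: field_simps)
      qed simp
      also have "\<dots> = ennreal (2 powr c) * ?\<phi> u" by (simp add: hardy_op_def ennreal_mult mult.assoc)
      finally show ?thesis .
    qed
    then have "(\<integral>\<^sup>+x. ?\<phi> t * indicator E x \<partial>I01) \<le> (\<integral>\<^sup>+x. ennreal (2 powr c) * (indicator E x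
      * ?\<phi> x) \<partial>I01)"
      by (intro nn_integral_mono) (auto simp: indicator_def)
    also have "\<dots> = ennreal (2 powr c) * (\<integral>\<^sup>+x. indicator E x * ?\<phi> x \<partial>I01)"
      by (intro nn_integral_cmult) measurable
    also have "\<dots> \<le> ennreal (2 powr c) * rint ?\<phi> s"
      using E mE s by (intro mult_left_mono rint_ge_set hardy_op_M_plus) (auto intro!: ennreal_leI)
    also have "(\<integral>\<^sup>+x. ?\<phi> t * indicator E x \<partial>I01) = ?\<phi> t * ennreal (s / 2)"
      using E by (simp add: nn_integral_cmult_indicator mE)
    finally have "ennreal 2 * (?\<phi> t * ennreal (s / 2)) \<le> ennreal 2 * (ennreal (2 powr c)
      * rint ?\<phi> s)"
      by (rule mult_left_mono) simp
    moreover have "ennreal 2 * ennreal (s / 2) = ennreal s"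
      using s by (simp flip: ennreal_mult del: ennreal_numeral)
    moreover have "ennreal 2 * ennreal (2 powr c) = ennreal (2 powr (c + 1))"
      by (simp add: powr_add mult.commute flip: ennreal_mult del: ennreal_numeral)
    ultimately show ?thesis
      by (metis mult.assoc mult.commute)
  qed
  then show ?thesis unfolding tail_sup_def SUP_mult_left_ennreal by (rule SUP_least)
qed

text \<open>On (0, s), G is at most G(s) plus a contribution of points t < s, whose integral is a
  multiple of s^c \<open>rint f s\<close>. The multiples of s G(s) are absorbed by
  \<open>tail_sup_hardy_op_le_rint\<close>, the other term by
  \<open>rint_hardy_op_ge\<close>.\<close>

lemma rint_tail_sup_hardy_op_le:
  assumes c: "0 < c"
  obtains K :: real where "0 < K"
    "\<And>f s. f \<in> M_plus \<Longrightarrow> 0 < s \<Longrightarrow> s \<le> 1 \<Longrightarrow>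
      rint (tail_sup (hardy_op c f)) s \<le> ennreal K * rint (hardy_op c f) s"
proof -
  \<comment> \<open>\<open>K1\<close> pays for two copies of s G(s), each costing 2^(c+1).
    \<open>K2\<close> is the factor 1 + 1/c from integrating the powers, times the 1 + c of
    \<open>rint_hardy_op_ge\<close>.\<close>
  define K1 where "K1 = 2 * 2 powr (c + 1)"
  define K2 where "K2 = (1 + 1 / c) * (1 + c)"
  have K: "0 < K1" "0 < K2" using c by (auto simp: K1_def K2_def add_pos_pos)
  have "rint (tail_sup (hardy_op c f)) s \<le> ennreal (K1 + K2) * rint (hardy_op c f) s"
    if f: "f \<in> M_plus" and s: "0 < s" "s \<le> 1" for f s
  proof -
    let ?\<phi> = "hardy_op c f"
    let ?G = "tail_sup ?\<phi>"
    \<comment> \<open>On [r, s) the power t^(c-1) is largest near s if c >= 1 and at r otherwise;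
      the sum of both endpoint values covers the two cases, and r^(c-1) is integrable at 0 because c
      > 0.\<close>
    have G_le: "?G r \<le> ?G s + ennreal (s powr (-1 + c) + r powr (-1 + c)) * rint f s" if r: "0 < r"
      "r < s" for r
      unfolding tail_sup_def[of _ r]
    proof (rule SUP_least)
      fix t assume t: "t \<in> {r..<1}"
      show "?\<phi> t \<le> ?G s + ennreal (s powr (-1 + c) + r powr (-1 + c)) * rint f s"
      proof (cases "s \<le> t")
        case True
        then show ?thesis using t by (intro add_increasing2 tail_sup_upper) auto
      next
        case False
        have "t powr (-1 + c) \<le> s powr (-1 + c) + r powr (-1 + c)"
        proof (cases "1 \<le> c")
          case True
          then have "t powr (-1 + c) \<le> s powr (-1 + c)" using False t r by (intro powr_mono2) auto
          then show ?thesis by (intro add_increasing2) auto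
        next
          case False
          then have "t powr (-1 + c) \<le> r powr (-1 + c)" using t r by (intro powr_mono2') auto
          then show ?thesis by (intro add_increasing) auto
        qed
        then have "?\<phi> t \<le> ennreal (s powr (-1 + c) + r powr (-1 + c)) * rint f s"
          unfolding hardy_op_def using False by (intro mult_mono ennreal_leI rint_mono) auto
        then show ?thesis by (intro add_increasing) auto
      qed
    qed
    have "(\<integral>\<^sup>+x. indicator {0<..<s} x * ?G x \<partial>I01)
        \<le> (\<integral>\<^sup>+x. (?G s + ennreal (s powr (-1 + c)) * rint f s) * indicator {0<..<s} x
             + (indicator {0<..<s} x * ennreal (x powr (-1 + c))) * rint f s \<partial>I01)"
      using G_le by (intro nn_integral_mono)
        (auto simp: indicator_def ennreal_plus distrib_right add.assoc)
    also have "\<dots> = (?G s + ennreal (s powr (-1 + c)) * rint f s) * ennreal s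
      + ennreal (s powr c / c) * rint f s"
    proof -
      have m: "(\<lambda>x. indicator {0<..<s} x * ennreal (x powr (-1 + c))) \<in> M_plus"
        by (rule borel_imp_M_plus) measurable
      show ?thesis
      proof (subst nn_integral_add)
        show "(\<integral>\<^sup>+x. (?G s + ennreal (s powr (-1 + c)) * rint f s) * indicator {0<..<s} x \<partial>I01)
           + (\<integral>\<^sup>+x. (indicator {0<..<s} x * ennreal (x powr (-1 + c))) * rint f s \<partial>I01)
           = (?G s + ennreal (s powr (-1 + c)) * rint f s) * ennreal s + ennreal
             (s powr c / c) * rint f s"
          using nn_integral_powr[of "-1 + c" s] s c m
          by (simp add: nn_integral_cmult nn_integral_multc nn_integral_indicator_initial)
      qed (use m in measurable)
    qed
    also have "\<dots> = ennreal s * ?G s + (ennreal (s powr (-1 + c)) * ennreal s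
      + ennreal (s powr c / c)) * rint f s"
      by (simp add: distrib_right distrib_left ac_simps)
    also have "ennreal (s powr (-1 + c)) * ennreal s = ennreal (s powr c)"
      using s powr_add[of s "-1 + c" 1] by (simp flip: ennreal_mult)
    also have "ennreal (s powr c) + ennreal (s powr c / c) = ennreal (1 + 1 / c)
      * ennreal (s powr c)"
      using c by (simp add: field_simps flip: ennreal_plus ennreal_mult)
    finally have int: "(\<integral>\<^sup>+x. indicator {0<..<s} x * ?G x \<partial>I01) \<le> ennreal s * ?G s + ennreal (1
      + 1 / c) * ennreal (s powr c) * rint f s" .
    \<comment> \<open>The tail bound costs a second copy of s G(s), a quantity already
      controlled.\<close>
    have "rint ?G s \<le> (\<integral>\<^sup>+x. indicator {0<..<s} x * ?G x \<partial>I01) + ennreal s * ?G s"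
      using s by (intro rint_le_tail tail_sup_M_plus tail_sup_antimono) auto
    also have "\<dots> \<le> (ennreal s * ?G s + ennreal (1 + 1 / c) * ennreal (s powr c) * rint f s)
      + ennreal s * ?G s"
      by (intro add_right_mono int)
    also have "\<dots> = ennreal 2 * (ennreal s * ?G s) + ennreal (1 + 1 / c) * (ennreal (s powr c)
      * rint f s)"
      by (simp add: mult_2 distrib_left ac_simps)
    also have "\<dots> \<le> ennreal 2 * (ennreal (2 powr (c + 1)) * rint ?\<phi> s) + ennreal (1 + 1 / c)
      * (ennreal (1 + c) * rint ?\<phi> s)"
      using s by (intro add_mono mult_left_mono tail_sup_hardy_op_le_rint rint_hardy_op_ge f c) auto
    also have "\<dots> = ennreal K1 * rint ?\<phi> s + ennreal K2 * rint ?\<phi> s"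
      unfolding K1_def K2_def using c by (simp add: ennreal_mult mult.assoc del: ennreal_plus)
    also have "\<dots> = ennreal (K1 + K2) * rint ?\<phi> s"
      using K by (simp add: distrib_right)
    finally show ?thesis .
  qed
  then show thesis using K by (intro that[of "K1 + K2"]) auto
qed

text \<open>The pointwise bounds pass to the norm by monotonicity; the term G is handled by
  comparing integrals of rearrangements. The constants are 1 + b and K + 1 / b.\<close>

lemma associate_norm_hardy_op_compose:
  assumes X: "ri_function_norm X" and a: "0 < a" and b: "0 < b"
  obtains c C :: real where "0 < c" "0 < C"
    "\<And>f. f \<in> M_plus \<Longrightarrow> associate_norm X (hardy_op (a + b) f) \<le> ennreal c
      * associate_norm X (hardy_op a (hardy_op b f))"
    "\<And>f. f \<in> M_plus \<Longrightarrow> associate_norm X (hardy_op a (hardy_op b f)) \<le> ennreal C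
      * associate_norm X (hardy_op (a + b) f)"
proof -
  note X' = ri_associate_norm[OF X]
  have ab: "0 < a + b" using a b by simp
  obtain K :: real where K: "0 < K" "\<And>f s. f \<in> M_plus \<Longrightarrow> 0 < s \<Longrightarrow> s \<le> 1 \<Longrightarrow>
      rint (tail_sup (hardy_op (a + b) f)) s \<le> ennreal K * rint (hardy_op (a + b) f) s"
    using rint_tail_sup_hardy_op_le[OF ab] by blast
  show thesis
  proof
    show "0 < 1 + b" "0 < K + 1 / b" using K b by (auto simp: add_pos_pos)
    fix f assume f: "f \<in> M_plus"
    let ?\<phi> = "hardy_op (a + b) f"
    have "associate_norm X ?\<phi> \<le> associate_norm X (\<lambda>s. ennreal (1 + b)
      * hardy_op a (hardy_op b f) s)"
      using hardy_op_add_le_compose[OF f b] by (intro associate_norm_mono AE_I2) auto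
    also have "\<dots> = ennreal (1 + b) * associate_norm X (hardy_op a (hardy_op b f))"
      using b by (intro ri_scale[OF X' hardy_op_M_plus]) simp
    finally show "associate_norm X ?\<phi> \<le> ennreal (1 + b)
      * associate_norm X (hardy_op a (hardy_op b f))" .
    have "associate_norm X (hardy_op a (hardy_op b f)) \<le> associate_norm X (\<lambda>s. tail_sup ?\<phi> s
      + ennreal (1 / b) * ?\<phi> s)"
      using hardy_op_compose_le[OF f a b] by (intro associate_norm_mono AE_I2) auto
    also have "\<dots> \<le> associate_norm X (tail_sup ?\<phi>) + associate_norm X (\<lambda>s. ennreal (1 / b) * ?\<phi> s)"
      using hardy_op_M_plus by (intro ri_triangle[OF X' tail_sup_M_plus]) measurable
    also have "associate_norm X (\<lambda>s. ennreal (1 / b) * ?\<phi> s) = ennreal (1 / b)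
      * associate_norm X ?\<phi>"
      using b by (intro ri_scale[OF X' hardy_op_M_plus]) simp
    also have "associate_norm X (tail_sup ?\<phi>) \<le> ennreal K * associate_norm X ?\<phi>"
      using K(2)[OF f] unfolding rint_def
      by (rule associate_norm_le_of_integrals_le[OF X tail_sup_M_plus hardy_op_M_plus])
    also have "ennreal K * associate_norm X ?\<phi> + ennreal (1 / b) * associate_norm X ?\<phi> = ennreal (K
      + 1 / b) * associate_norm X ?\<phi>"
      using K b by (simp add: distrib_right)
    finally show "associate_norm X (hardy_op a (hardy_op b f)) \<le> ennreal (K + 1 / b)
      * associate_norm X ?\<phi>"
      by (simp add: add_right_mono)
  qed
qed

text \<open>Duality reverses the order: g from the unit ball of the associate of A lies, after
  division by c, in that of the associate of B, where \<open>hoelder\<close> applies. The supremum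
  over g gives back A f by \<open>lorentz_luxemburg\<close>.\<close>

lemma norm_le_of_associate_norm_le:
  assumes A: "ri_function_norm A" and B: "ri_function_norm B" and c: "0 < c"
    and le: "\<And>g. g \<in> M_plus \<Longrightarrow> associate_norm B g \<le> ennreal c * associate_norm A g"
    and f: "f \<in> M_plus"
  shows "A f \<le> ennreal c * B f"
proof -
  have "associate_norm (associate_norm A) f \<le> ennreal c * B f"
  proof (rule associate_norm_least)
    fix g assume g: "g \<in> M_plus" "associate_norm A g \<le> 1"
    note [measurable] = f g(1)
    have g': "(\<lambda>s. ennreal (1 / c) * g s) \<in> M_plus" by measurable
    have "associate_norm B (\<lambda>s. ennreal (1 / c) * g s) = ennreal (1 / c) * associate_norm B g"
      using c by (intro ri_scale[OF ri_associate_norm[OF B] g(1)]) simp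
    also have "\<dots> \<le> ennreal (1 / c) * (ennreal c * 1)"
      by (intro mult_left_mono order_trans[OF le[OF g(1)]] g(2)) auto
    also have "\<dots> = 1" using c by (simp flip: ennreal_mult)
    finally have "(\<integral>\<^sup>+ s. f s * (ennreal (1 / c) * g s) \<partial>I01) \<le> B f"
      by (rule hoelder[OF B f g'])
    then have "ennreal c * (\<integral>\<^sup>+ s. f s * (ennreal (1 / c) * g s) \<partial>I01) \<le> ennreal c * B f"
      by (rule mult_left_mono) simp
    also have "ennreal c * (\<integral>\<^sup>+ s. f s * (ennreal (1 / c) * g s) \<partial>I01) = (\<integral>\<^sup>+ s. ennreal c * (f s
      * (ennreal (1 / c) * g s)) \<partial>I01)"
      by (intro nn_integral_cmult[symmetric]) measurable
    also have "\<dots> = (\<integral>\<^sup>+ s. g s * f s \<partial>I01)"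
    proof (intro nn_integral_cong)
      fix s
      have "ennreal c * (f s * (ennreal (1 / c) * g s)) = (ennreal c * ennreal (1 / c)) * (g s
        * f s)" by (simp only: ac_simps)
      also have "ennreal c * ennreal (1 / c) = 1" using c by (simp flip: ennreal_mult)
      finally show "ennreal c * (f s * (ennreal (1 / c) * g s)) = g s * f s" by simp
    qed
    finally show "(\<integral>\<^sup>+ s. g s * f s \<partial>I01) \<le> ennreal c * B f" .
  qed
  then show ?thesis by (simp only: lorentz_luxemburg[OF A f])
qed

lemma ri_spaces_equivalentI:
  assumes c: "0 < c" and C: "0 < C"
    and AB: "\<And>f. f \<in> M_plus \<Longrightarrow> A f \<le> ennreal c * B f"
    and BA: "\<And>f. f \<in> M_plus \<Longrightarrow> B f \<le> ennreal C * A f"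
  shows "ri_spaces_equivalent A B \<Omega>"
proof -
  have le: "ri_norm_on A \<Omega> u \<le> ennreal c * ri_norm_on B \<Omega> u" "ri_norm_on B \<Omega> u \<le> ennreal C
    * ri_norm_on A \<Omega> u" for u
    unfolding ri_norm_on_def by (intro AB BA rearr_M_plus)+
  have "ri_norm_on A \<Omega> u < top \<longleftrightarrow> ri_norm_on B \<Omega> u < top" for u
    using le[of u] by (auto simp: ennreal_mult_less_top elim!: le_less_trans)
  then have "ri_space A \<Omega> = ri_space B \<Omega>" by (auto simp: ri_space_def)
  \<comment> \<open>The definition asks for a lower bound on the norm of B, so \<open>AB\<close> is
    inverted.\<close>
  moreover have "ennreal (1 / c) * ri_norm_on A \<Omega> u \<le> ri_norm_on B \<Omega> u" for u
  proof -
    have "ennreal (1 / c) * ri_norm_on A \<Omega> u \<le> ennreal (1 / c) * (ennreal c * ri_norm_on B \<Omega> u)"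
      by (intro mult_left_mono le) simp
    also have "\<dots> = (ennreal (1 / c) * ennreal c) * ri_norm_on B \<Omega> u" by (simp only: mult.assoc)
    also have "ennreal (1 / c) * ennreal c = 1" using c by (simp flip: ennreal_mult)
    finally show ?thesis by simp
  qed
  ultimately show ?thesis
    unfolding ri_spaces_equivalent_def using c C le by (intro conjI exI[of _
      "1 / c"] exI[of _ C]) auto
qed

theorem theorem6p3:
  fixes \<Omega> :: "(real ^ 'n) set"
    and X :: "(real \<Rightarrow> ennreal) \<Rightarrow> ennreal"
    and k h :: nat
  assumes "CARD('n) \<ge> 2"
    and "john_domain \<Omega>"
    and "emeasure lebesgue \<Omega> = 1"
    and "ri_function_norm X"
    and "k \<ge> 1" and "h \<ge> 1"
  shows "ri_spaces_equivalent
           (john_norm CARD('n) h (john_norm CARD('n) k X))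
           (john_norm CARD('n) (k + h) X)
           \<Omega>"
proof -
  let ?n = "CARD('n)"
  define a where "a = real k / real ?n"
  define b where "b = real h / real ?n"
  let ?J = "john_norm ?n k X"
  let ?A = "john_norm ?n h ?J"
  let ?B = "john_norm ?n (k + h) X"
  have ab: "0 < a" "0 < b" using assms(1,5,6) by (auto simp: a_def b_def)
  have n: "1 \<le> ?n" using assms(1) by simp
  note J = john_norm_properties[OF assms(4) n assms(5), folded a_def]
  note A = john_norm_properties[OF J(1) n assms(6), folded b_def]
  have "1 \<le> k + h" using assms(5) by simp
  note B = john_norm_properties[OF assms(4) n this]
  have ab_eq: "real (k + h) / real ?n = a + b" by (simp add: a_def b_def add_divide_distrib)
  \<comment> \<open>The outer construction, with index h, applies its operator to f before the
    associate of \<open>?J\<close> is evaluated, so \<open>hardy_op b\<close> stands inside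
    \<open>hardy_op a\<close>.\<close>
  have A_eq: "associate_norm ?A f = associate_norm X (hardy_op a (hardy_op b f))" if "f \<in> M_plus" for f
    using A(2)[OF that] J(2)[OF hardy_op_M_plus] by (simp only:)
  have B_eq: "associate_norm ?B f = associate_norm X (hardy_op (a + b) f)" if "f \<in> M_plus" for f
    using B(2)[OF that] by (simp only: ab_eq)
  obtain c C :: real where cC: "0 < c" "0 < C"
    "\<And>f. f \<in> M_plus \<Longrightarrow> associate_norm X (hardy_op (a + b) f) \<le> ennreal c * associate_norm X (hardy_op a (hardy_op b f))"
    "\<And>f. f \<in> M_plus \<Longrightarrow> associate_norm X (hardy_op a (hardy_op b f)) \<le> ennreal C * associate_norm X (hardy_op (a + b) f)"
    using associate_norm_hardy_op_compose[OF assms(4) ab] by blast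
  show ?thesis
  proof (rule ri_spaces_equivalentI[OF cC(1,2)])
    \<comment> \<open>The constant c bounds the associate of \<open>?B\<close> by that of
      \<open>?A\<close>, hence \<open>?A\<close> by \<open>?B\<close>.\<close>
    show "?A f \<le> ennreal c * ?B f" if "f \<in> M_plus" for f
      by (rule norm_le_of_associate_norm_le[OF A(1) B(1) cC(1) _ that]) (simp only: A_eq B_eq cC(3))
    show "?B f \<le> ennreal C * ?A f" if "f \<in> M_plus" for f
      by (rule norm_le_of_associate_norm_le[OF B(1) A(1) cC(2) _ that]) (simp only: A_eq B_eq cC(4))
  qed
qed

end
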